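(* For every integer $k\ge1$, every real $p>-1$ and every integer $n\geq 1$, $$\gamma_k^{+}=j_{p+1,n}^{2}\,E_k\!\left(p,j_{p+1,n}^{2}\right).$$ Moreover, as polynomials in $p,y$, $$\deg_y E_k(p,y)=\left\lfloor\frac{k-1}{2}\right\rfloor,\qquad \deg_p E_k(p,y)=k-1,$$ and the coefficient of $p^{k-1}$ in $E_k(p,y)$ is exactly $\dfrac{(-1)^{k-1}}{4\,k!}$. Consequently, for every integer $r\ge2$, every real $p>-1$ and every integer $n\ge1$, $$\mathcal T_r^{+}(p,n)=\frac{E_{r-1}\!\left(p,j_{p+1,n}^{2}\right)}{\left(j_{p+1,n}^{2}\right)^{r-1}},$$ where the numerator polynomial $E_{r-1}(p,y)$ satisfies $\deg_y E_{r-1}=\left\lfloor\frac{r-2}{2}\right\rfloor$ and $\deg_p E_{r-1}=r-2$; equivalently to the former, the degree in $z$ of $E_{r-1}(p,z^2)$ (with $z$ standing for $j_{p+1,n}$) is $2\left\lfloor\frac{r-2}{2}\right\rfloor$, that is, $r-2$ if $r$ is even and $r-3$ if $r$ is odd.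
   Context: For real $\nu>-1$, $J_\nu$ is the Bessel function of the first kind of order $\nu$ and $j_{\nu,m}$ denotes its $m$th positive zero ($m\ge1$). For $p>-1$ and integers $r,n\ge1$, $$\mathcal T_r^{+}(p,n)=\sum_{m\ge1}\frac{1}{\left(j_{p,m}^{2}-j_{p+1,n}^{2}\right)^r}.$$ Let $D_p(x)=\dfrac{J_{p+1}(\sqrt{x})}{2\sqrt{x}\,J_p(\sqrt{x})}=\sum_{m\ge1}\dfrac{1}{j_{p,m}^2-x}$, which is analytic near $x=j_{p+1,n}^2$, and for $k\ge0$ let $$\beta_k^{+}=\frac{D_p^{(k)}\left(j_{p+1,n}^2\right)}{k!}=\mathcal T_{k+1}^{+}(p,n),\qquad \gamma_k^{+}=\left(j_{p+1,n}^{2}\right)^{k+1}\beta_k^{+}.$$ The two-variable polynomials $E_k(p,y)$, $k\geq 1$, are defined by $E_1(p,y)=\frac14$ and, for $k\ge1$, $$E_{k+1}(p,y)=\frac{1}{k+1}\left[y\sum_{j=1}^{k-1}E_j(p,y)E_{k-j}(p,y)+y\sum_{j=1}^{k-2}E_j(p,y)E_{k-1-j}(p,y)-(k+p+1)E_k(p,y)\right],$$ where empty sums are zero. Degrees in $p$ and $y$ refer to $E_k$ as a polynomial in the two indeterminates $p,y$. *)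

theory Defs
  imports
    "HOL-Analysis.Analysis"
    "HOL-Computational_Algebra.Polynomial"
begin

definition bessel_J :: "real \<Rightarrow> real \<Rightarrow> real" where
  "bessel_J \<nu> x =
     (x / 2) powr \<nu> * (\<Sum>k. (-1) ^ k / (fact k * Gamma (\<nu> + real k + 1)) * (x / 2) ^ (2 * k))"

text \<open>
  \<open>bessel_J\<close> is meant for \<open>\<nu> > -1\<close> and \<open>x > 0\<close>.  The \<open>m\<close>-th positive zero, counted from
  \<open>m = 1\<close>, is the positive zero \<open>x\<close> for which exactly \<open>m\<close> positive zeros are at most \<open>x\<close>.
  All positive zeros are simple, so counting distinct zeros agrees with counting multiplicities.
\<close>

definition bessel_zero :: "real \<Rightarrow> nat \<Rightarrow> real" where
  "bessel_zero \<nu> m =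
     (THE x. 0 < x \<and> bessel_J \<nu> x = 0 \<and> card {t. 0 < t \<and> t \<le> x \<and> bessel_J \<nu> t = 0} = m)"

definition T_plus :: "nat \<Rightarrow> real \<Rightarrow> nat \<Rightarrow> real" where
  "T_plus r p n =
     (\<Sum>\<^sub>\<infinity>m\<in>{1..}. 1 / ((bessel_zero p m)\<^sup>2 - (bessel_zero (p + 1) n)\<^sup>2) ^ r)"

definition D_fun :: "real \<Rightarrow> real \<Rightarrow> real" where
  "D_fun p x = bessel_J (p + 1) (sqrt x) / (2 * sqrt x * bessel_J p (sqrt x))"

definition beta_plus :: "real \<Rightarrow> nat \<Rightarrow> nat \<Rightarrow> real" where
  "beta_plus p n k = (deriv ^^ k) (D_fun p) ((bessel_zero (p + 1) n)\<^sup>2) / fact k"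

definition gamma_plus :: "real \<Rightarrow> nat \<Rightarrow> nat \<Rightarrow> real" where
  "gamma_plus p n k = ((bessel_zero (p + 1) n)\<^sup>2) ^ (k + 1) * beta_plus p n k"

text \<open>
  A polynomial in the two indeterminates \<open>p\<close> and \<open>y\<close> is a polynomial in \<open>y\<close> (outer level)
  whose coefficients are polynomials in \<open>p\<close> (inner level).
\<close>

type_synonym poly_py = "real poly poly"

definition var_p :: poly_py where
  "var_p = [:[:0, 1:]:]"

definition var_y :: poly_py where
  "var_y = [:0, 1:]"

definition const_py :: "real \<Rightarrow> poly_py" where
  "const_py c = [:[:c:]:]"

definition eval_py :: "poly_py \<Rightarrow> real \<Rightarrow> real \<Rightarrow> real" where
  "eval_py q p y = poly (poly q [:y:]) p"

definition degree_y :: "poly_py \<Rightarrow> nat" where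
  "degree_y q = degree q"

definition degree_p :: "poly_py \<Rightarrow> nat" where
  "degree_p q = Max ((\<lambda>i. degree (coeff q i)) ` {..degree q})"

text \<open>The coefficient of \<open>p ^ i\<close>, as a polynomial in \<open>y\<close>.\<close>

definition coeff_p :: "poly_py \<Rightarrow> nat \<Rightarrow> real poly" where
  "coeff_p q i = map_poly (\<lambda>c. coeff c i) q"

text \<open>Substituting \<open>y = z\<^sup>2\<close> gives a polynomial in \<open>z\<close> over the polynomials in \<open>p\<close>.\<close>

definition subst_square :: "poly_py \<Rightarrow> real poly poly" where
  "subst_square q = pcompose q (monom 1 2)"

text \<open>
  The value at \<open>0\<close> is a dummy, since the polynomials are indexed from \<open>1\<close>; it is not used by
  the recursion.  See \<open>E_poly_rec\<close> for the recurrence in its usual indexing.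
\<close>

fun E_poly :: "nat \<Rightarrow> poly_py" where
  "E_poly 0 = 0"
| "E_poly (Suc 0) = const_py (1 / 4)"
| "E_poly (Suc (Suc i)) =
     const_py (1 / (real i + 2)) *
       (var_y * (\<Sum>j = 1..i. E_poly j * E_poly (Suc i - j))
        + var_y * (\<Sum>j = 1..i - 1. E_poly j * E_poly (i - j))
        - (const_py (real i + 2) + var_p) * E_poly (Suc i))"

lemma E_poly_rec:
  assumes "k \<ge> 1"
  shows "E_poly (k + 1) =
     const_py (1 / (real k + 1)) *
       (var_y * (\<Sum>j = 1..k - 1. E_poly j * E_poly (k - j))
        + var_y * (\<Sum>j = 1..k - 2. E_poly j * E_poly (k - 1 - j))
        - (const_py (real k + 1) + var_p) * E_poly k)"
proof -
  obtain i where "k = Suc i"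
    using assms by (cases k) auto
  then show ?thesis
    by (simp add: add_ac)
qed

end

theory Submission
  imports Defs "HOL-Complex_Analysis.Complex_Analysis"
begin

text \<open>
  Write \<open>J\<^sub>p(x) = (x/2)\<^bsup>p\<^esup> F\<^sub>p(x\<^sup>2)\<close> with \<open>F\<^sub>p\<close> entire, so that
  \<open>F\<^sub>p' = - F\<^sub>p\<^sub>+\<^sub>1 / 4\<close> and \<open>D\<^sub>p = - F\<^sub>p' / F\<^sub>p\<close>. Bessel's equation becomes the Riccati
  equation \<open>x D' = x D\<^sup>2 - (p + 1) D + 1/4\<close>; comparing Taylor coefficients at a zero
  \<open>y\<close> of \<open>F\<^sub>p\<^sub>+\<^sub>1\<close>, where \<open>D\<^sub>p\<close> vanishes, gives the recurrence of the \<open>E\<^sub>k\<close>.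

  The expansion of \<open>D\<^sub>p\<close> over the zeros is the genus zero case of Hadamard's theorem:
  dividing \<open>F\<^sub>p\<close> by \<open>\<Prod>(1 - z/a)\<close> over its zeros with \<open>\<bar>a\<bar> \<le> R\<close> leaves a function \<open>h\<close> without
  zeros in the disc of radius \<open>R\<close>, bounded there by the maximum of \<open>\<bar>F\<^sub>p\<bar>\<close> on the circle of
  radius \<open>2 R\<close>, since every factor is at least \<open>1\<close> in modulus on that circle. As
  \<open>\<bar>F\<^sub>p(z)\<bar> \<le> C exp(\<epsilon>\<bar>z\<bar>)\<close> for every \<open>\<epsilon> > 0\<close>, the Borel-Caratheodory inequality shows that
  \<open>h'/h\<close> and its derivatives tend to \<open>0\<close> as \<open>R\<close> grows. The same estimate shows that \<open>F\<^sub>p\<close>, not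
  being a polynomial, has infinitely many zeros.
\<close>

section \<open>Degrees of the polynomials $E_k$\<close>

text \<open>Multiplication by \<open>var_y\<close> becomes a shift of the outer coefficients and all
  other factors become scalars from the inner ring, so coefficients can be read off by
  simplification.\<close>

lemma E_poly_smult:
  "E_poly (Suc (Suc i)) = smult [:1 / (real i + 2):]
     (pCons 0 ((\<Sum>j = 1..i. E_poly j * E_poly (Suc i - j))
        + (\<Sum>j = 1..i - 1. E_poly j * E_poly (i - j)))
      - smult [:real i + 2, 1:] (E_poly (Suc i)))"
  by (simp add: const_py_def var_y_def var_p_def smult_add_left)

section \<open>Degree and top coefficient in \<open>p\<close>\<close>

text \<open>The bounds \<open>a\<close> and \<open>b\<close> on the inner degrees are exclusive. If
  \<open>t < a\<close> and \<open>m - t < b\<close>, then \<open>m + 2 <= a + b\<close>; otherwise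
  one factor of each term in the inner convolution vanishes.\<close>

lemma coeff_mult_eq_0_of_degree_lt:
  fixes q r :: "'a::idom poly poly"
  assumes "\<And>i m. m \<ge> a \<Longrightarrow> coeff (coeff q i) m = 0"
    and "\<And>i m. m \<ge> b \<Longrightarrow> coeff (coeff r i) m = 0"
    and "m + 1 \<ge> a + b"
  shows "coeff (coeff (q * r) i) m = 0"
proof -
  have "coeff (coeff q s * coeff r (i - s)) m = 0" for s
  proof -
    have "coeff (coeff q s) t * coeff (coeff r (i - s)) (m - t) = 0" if "t \<le> m" for t
    proof (cases "t \<ge> a")
      case False
      then have "m - t \<ge> b" using assms(3) that by linarith
      then show ?thesis using assms(2) by simp
    qed (use assms(1) in simp)
    then show ?thesis unfolding coeff_mult by (intro sum.neutral) simp
  qed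
  then show ?thesis by (simp add: coeff_mult[of q r] coeff_sum)
qed

text \<open>The products in the recurrence have too small a degree in \<open>p\<close> to reach the
  top, so the coefficient of \<open>p ^ (k - 1)\<close> comes from
  \<open>- p * E_poly (k - 1)\<close> alone and is divided by \<open>- k\<close> at each step. In
  particular it is constant in \<open>y\<close>. The degree bound and the top coefficient are proved
  in one induction.\<close>

lemma E_poly_coeff_p:
  "(\<forall>i m. m \<ge> k \<longrightarrow> coeff (coeff (E_poly k) i) m = 0) \<and>
   (k \<ge> 1 \<longrightarrow> (\<forall>i. coeff (coeff (E_poly k) i) (k - 1) =
      (if i = 0 then (-1) ^ (k - 1) / (4 * fact k) else 0)))"
proof (induction k rule: less_induct)
  case (less k)
  consider "k = 0" | "k = 1" | l where "k = Suc (Suc l)"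
    by (metis One_nat_def not0_implies_Suc)
  then show ?case
  proof cases
    case 3
    have IH: "coeff (coeff (E_poly j) i) m = 0" if "j < k" "m \<ge> j" for j i m
      using less.IH that by blast
    have top: "coeff (coeff (E_poly (Suc l)) i) l =
        (if i = 0 then (-1) ^ l / (4 * fact (Suc l)) else 0)" for i
      using less.IH[of "Suc l"] 3 by auto
    define S where "S = (\<Sum>j = 1..l. E_poly j * E_poly (Suc l - j))
        + (\<Sum>j = 1..l - 1. E_poly j * E_poly (l - j))"
    have S0: "coeff (coeff S i) m = 0" if "m \<ge> l" for i m
    proof -
      have "coeff (coeff (E_poly j * E_poly (Suc l - j)) i) m = 0" if "j \<in> {1..l}" for j
        by (rule coeff_mult_eq_0_of_degree_lt[of j _ "Suc l - j"])
           (use IH 3 that \<open>m \<ge> l\<close> in auto)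
      moreover have "coeff (coeff (E_poly j * E_poly (l - j)) i) m = 0" if "j \<in> {1..l - 1}" for j
        by (rule coeff_mult_eq_0_of_degree_lt[of j _ "l - j"])
           (use IH 3 that \<open>m \<ge> l\<close> in auto)
      ultimately show ?thesis unfolding S_def by (simp add: coeff_sum)
    qed
    \<comment> \<open>The factor \<open>var_y\<close> lowers the outer index \<open>i\<close> by
      one, the factor \<open>var_p\<close> the inner index \<open>m\<close>.\<close>
    have rec: "coeff (coeff (E_poly k) i) m = 1 / (real l + 2) *
        ((if i = 0 then 0 else coeff (coeff S (i - 1)) m)
          - ((real l + 2) * coeff (coeff (E_poly (Suc l)) i) m
             + (if m = 0 then 0 else coeff (coeff (E_poly (Suc l)) i) (m - 1))))" for i m
      unfolding 3 E_poly_smult S_def[symmetric]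
      by (auto simp: coeff_pCons split: nat.split)
    show ?thesis
    proof (intro conjI allI impI)
      fix i m assume "k \<le> m"
      then show "coeff (coeff (E_poly k) i) m = 0"
        unfolding rec using 3 by (simp add: S0 IH)
    next
      fix i
      have "coeff (coeff (E_poly (Suc l)) i) (Suc l) = 0" "coeff (coeff S (i - 1)) (Suc l) = 0"
        using IH S0 3 by auto
      moreover have "- ((-1) ^ l / (4 * fact (Suc l))) / (real l + 2)
          = (-1) ^ Suc l / (4 * fact (Suc (Suc l)) :: real)"
        by (simp add: field_simps)
      ultimately show "coeff (coeff (E_poly k) i) (k - 1) =
          (if i = 0 then (-1) ^ (k - 1) / (4 * fact k) else 0)"
        unfolding rec using 3 top by simp
    qed
  qed (auto simp: const_py_def coeff_pCons split: nat.splits)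
qed

text \<open>The maximum over the powers of \<open>y\<close> is attained at \<open>y ^ 0\<close>,
  which carries the nonzero top coefficient.\<close>

lemma degree_p_E_poly:
  assumes "k \<ge> 1"
  shows "degree_p (E_poly k) = k - 1"
proof -
  have le: "degree (coeff (E_poly k) i) \<le> k - 1" for i
    using E_poly_coeff_p[of k] assms by (intro degree_le) auto
  have "degree (coeff (E_poly k) 0) \<ge> k - 1"
    using E_poly_coeff_p[of k] assms by (intro le_degree) auto
  with le[of 0] have "degree (coeff (E_poly k) 0) = k - 1" by linarith
  then have "k - 1 \<in> (\<lambda>i. degree (coeff (E_poly k) i)) ` {..degree (E_poly k)}"
    by (metis atMost_iff image_eqI zero_le)
  then show ?thesis
    unfolding degree_p_def using le by (intro Max_eqI) auto
qed

lemma coeff_p_E_poly: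
  assumes "k \<ge> 1"
  shows "coeff_p (E_poly k) (k - 1) = [:(-1) ^ (k - 1) / (4 * fact k):]"
  using E_poly_coeff_p[of k] assms unfolding coeff_p_def
  by (intro poly_eqI) (auto simp: coeff_map_poly coeff_pCons split: nat.splits)

section \<open>Degree in \<open>y\<close>\<close>

text \<open>Upper bounds on the degrees suffice: only the index \<open>m\<close> keeps both factors
  of a convolution term within their bounds. This suits the induction below, where the degree bound
  and the sign of the top coefficient are separate claims.\<close>

lemma coeff_mult_top:
  fixes p q :: "'a::comm_semiring_0 poly"
  assumes "degree p \<le> m" "degree q \<le> n"
  shows "coeff (p * q) (m + n) = coeff p m * coeff q n"
proof -
  have "coeff (p * q) (m + n) = (\<Sum>i\<le>m + n. coeff p i * coeff q (m + n - i))"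
    by (rule coeff_mult)
  also have "\<dots> = (\<Sum>i\<in>{m}. coeff p i * coeff q (m + n - i))"
  proof (rule sum.mono_neutral_right)
    show "\<forall>i\<in>{..m + n} - {m}. coeff p i * coeff q (m + n - i) = 0"
    proof
      fix i assume "i \<in> {..m + n} - {m}"
      then have "i > m \<or> m + n - i > n" by auto
      then show "coeff p i * coeff q (m + n - i) = 0"
        using assms coeff_eq_0[of p i] coeff_eq_0[of q "m + n - i"] by auto
    qed
  qed auto
  finally show ?thesis by simp
qed

text \<open>The top coefficients in \<open>y\<close> cannot cancel in the recurrence: for odd \<open>k\<close> they are positive
  constants, and for even \<open>k\<close> all contributions to their linear coefficient in \<open>p\<close> are
  nonpositive, that of \<open>- p * E_poly (k - 1)\<close> being negative.\<close>

lemma E_poly_lead_y: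
  assumes "k \<ge> 1"
  shows "degree (E_poly k) \<le> (k - 1) div 2 \<and>
    (odd k \<longrightarrow> coeff (coeff (E_poly k) ((k - 1) div 2)) 0 > 0 \<and>
       (\<forall>n>0. coeff (coeff (E_poly k) ((k - 1) div 2)) n = 0)) \<and>
    (even k \<longrightarrow> coeff (coeff (E_poly k) ((k - 1) div 2)) 1 < 0)"
  using assms
proof (induction k rule: less_induct)
  case (less k)
  consider "k = 1" | l where "k = Suc (Suc l)"
    using less.prems by (metis One_nat_def not0_implies_Suc not_one_le_zero)
  then show ?case
  proof cases
    case 1
    then show ?thesis by (auto simp: const_py_def coeff_pCons split: nat.splits)
  next
    case 2
    have deg: "degree (E_poly j) \<le> (j - 1) div 2" if "j < k" "j \<ge> 1" for j
      using less.IH that by blast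
    have pos: "coeff (coeff (E_poly j) ((j - 1) div 2)) 0 > 0"
      and const: "\<And>n. n > 0 \<Longrightarrow> coeff (coeff (E_poly j) ((j - 1) div 2)) n = 0"
      if "j < k" "odd j" for j
      using less.IH[of j] that by (auto simp: odd_pos Suc_leI)
    have neg: "coeff (coeff (E_poly j) ((j - 1) div 2)) 1 < 0" if "j < k" "j \<ge> 1" "even j" for j
      using less.IH[of j] that by auto
    have prod_deg: "degree (E_poly a * E_poly b) \<le> (a - 1) div 2 + (b - 1) div 2"
      if "a < k" "b < k" "a \<ge> 1" "b \<ge> 1" for a b
      using degree_mult_le[of "E_poly a" "E_poly b"] deg[of a] deg[of b] that by linarith
    have prod_top: "coeff (E_poly a * E_poly b) ((a - 1) div 2 + (b - 1) div 2)
        = coeff (E_poly a) ((a - 1) div 2) * coeff (E_poly b) ((b - 1) div 2)"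
      if "a < k" "b < k" "a \<ge> 1" "b \<ge> 1" for a b
      using that by (intro coeff_mult_top deg)
    define S1 where "S1 = (\<Sum>j = 1..l. E_poly j * E_poly (Suc l - j))"
    define S2 where "S2 = (\<Sum>j = 1..l - 1. E_poly j * E_poly (l - j))"
    have rec: "coeff (coeff (E_poly k) i) n = 1 / (real l + 2) *
        ((if i = 0 then 0 else coeff (coeff S1 (i - 1)) n + coeff (coeff S2 (i - 1)) n)
          - ((real l + 2) * coeff (coeff (E_poly (Suc l)) i) n
             + (if n = 0 then 0 else coeff (coeff (E_poly (Suc l)) i) (n - 1))))" for i n
      unfolding 2 E_poly_smult S1_def[symmetric] S2_def[symmetric]
      by (auto simp: coeff_pCons split: nat.split)
    have bound1: "degree (E_poly j * E_poly (Suc l - j)) \<le> (l - 1) div 2" if "j \<in> {1..l}" for j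
    proof -
      have "degree (E_poly j * E_poly (Suc l - j)) \<le> (j - 1) div 2 + (Suc l - j - 1) div 2"
        using that 2 by (intro prod_deg) auto
      also have "\<dots> \<le> (l - 1) div 2" using that by simp linarith
      finally show ?thesis .
    qed
    have bound2: "degree (E_poly j * E_poly (l - j)) \<le> (l - 2) div 2" if "j \<in> {1..l - 1}" for j
    proof -
      have "degree (E_poly j * E_poly (l - j)) \<le> (j - 1) div 2 + (l - j - 1) div 2"
        using that 2 by (intro prod_deg) auto
      also have "\<dots> \<le> (l - 2) div 2" using that by simp linarith
      finally show ?thesis .
    qed
    have dS1: "degree S1 \<le> (l - 1) div 2"
      unfolding S1_def by (rule degree_sum_le) (use bound1 in auto)
    have dS2: "degree S2 \<le> (l - 2) div 2"
      unfolding S2_def by (rule degree_sum_le) (use bound2 in auto)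
    \<comment> \<open>For \<open>l = 0\<close> and \<open>l = 1\<close> the truncated bounds
      \<open>(l - 1) div 2\<close> and \<open>(l - 2) div 2\<close> may be too weak; the sums
      concerned are then empty.\<close>
    have S0: "S1 = 0" "S2 = 0" if "l = 0" using that by (auto simp: S1_def S2_def)
    have S20: "S2 = 0" if "l = 1" using that by (auto simp: S2_def)
    have dE: "degree (E_poly (Suc l)) \<le> l div 2" using deg[of "Suc l"] 2 by simp
    have "degree (E_poly k) \<le> (k - 1) div 2"
    proof (rule degree_le, intro allI impI poly_eqI)
      fix i n assume i: "(k - 1) div 2 < i"
      have "S1 = 0 \<or> degree S1 < i - 1" "S2 = 0 \<or> degree S2 < i - 1"
        using i 2 dS1 dS2 S0 by linarith+
      then have "coeff S1 (i - 1) = 0" "coeff S2 (i - 1) = 0"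
        by (auto intro: coeff_eq_0)
      moreover have "coeff (E_poly (Suc l)) i = 0" using i 2 dE by (intro coeff_eq_0) linarith
      ultimately show "coeff (coeff (E_poly k) i) n = coeff 0 n" unfolding rec by simp
    qed
    moreover have "coeff (coeff (E_poly k) ((k - 1) div 2)) 0 > 0 \<and>
       (\<forall>n>0. coeff (coeff (E_poly k) ((k - 1) div 2)) n = 0)" if "odd k"
    proof -
      have "odd l" using that 2 by simp
      then obtain m where m: "l = 2 * m + 1" by (rule oddE)
      have i: "(k - 1) div 2 = Suc m" using m 2 by simp
      have E0: "coeff (E_poly (Suc l)) (Suc m) = 0" using dE m by (intro coeff_eq_0) auto
      have S20: "coeff S2 m = 0"
      proof (cases "m = 0")
        case False
        then show ?thesis using dS2 m by (intro coeff_eq_0) auto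
      qed (use m S20 in simp)
      \<comment> \<open>The indices have equal parity. If both are even, their degree bounds add up
        to \<open>m - 1\<close> only, so just the products with two odd indices reach
        \<open>y ^ m\<close>.\<close>
      have even0: "coeff (E_poly j * E_poly (Suc l - j)) m = 0" if j: "j \<in> {1..l}" "even j" for j
      proof (rule coeff_eq_0)
        have "degree (E_poly j * E_poly (Suc l - j)) \<le> (j - 1) div 2 + (Suc l - j - 1) div 2"
          using j 2 by (intro prod_deg) auto
        also have "\<dots> < m"
        proof -
          obtain a where a: "j = 2 * a" using j(2) by (rule evenE)
          then have "j - 1 = 2 * (a - 1) + 1" "Suc l - j - 1 = 2 * (m - a) + 1" "1 \<le> a" "a \<le> m"
            using j(1) m by auto
          then show ?thesis by simp
        qed
        finally show "degree (E_poly j * E_poly (Suc l - j)) < m" .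
      qed
      have odd1: "coeff (E_poly j * E_poly (Suc l - j)) m
          = coeff (E_poly j) ((j - 1) div 2) * coeff (E_poly (Suc l - j)) ((Suc l - j - 1) div 2)"
        if j: "j \<in> {1..l}" "odd j" for j
      proof -
        obtain a where "j = 2 * a + 1" using j(2) by (rule oddE)
        then have "(j - 1) div 2 + (Suc l - j - 1) div 2 = m" using j(1) m by simp
        then show ?thesis using prod_top[of j "Suc l - j"] j 2 by auto
      qed
      have o: "coeff (coeff (E_poly j * E_poly (Suc l - j)) m) 0 > 0"
          "n > 0 \<Longrightarrow> coeff (coeff (E_poly j * E_poly (Suc l - j)) m) n = 0"
        if j: "j \<in> {1..l}" "odd j" for j n
      proof -
        have jj: "Suc l - j < k" "odd (Suc l - j)" "j < k" using j 2 m by auto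
        show "coeff (coeff (E_poly j * E_poly (Suc l - j)) m) 0 > 0"
          unfolding odd1[OF j] using pos[of j] pos[of "Suc l - j"] j jj
          by (simp add: coeff_mult_0)
        show "coeff (coeff (E_poly j * E_poly (Suc l - j)) m) n = 0" if "n > 0"
          unfolding odd1[OF j] unfolding coeff_mult
        proof (rule sum.neutral, intro ballI)
          fix t assume "t \<in> {..n}"
          then have "t > 0 \<or> n - t > 0" using that by auto
          then show "coeff (coeff (E_poly j) ((j - 1) div 2)) t *
            coeff (coeff (E_poly (Suc l - j)) ((Suc l - j - 1) div 2)) (n - t) = 0"
            using const[of j] const[of "Suc l - j"] j jj by auto
        qed
      qed
      have "coeff (coeff S1 m) 0 > 0"
        unfolding S1_def coeff_sum
      proof (rule sum_pos2[of _ 1])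
        fix j assume "j \<in> {1..l}"
        then show "0 \<le> coeff (coeff (E_poly j * E_poly (Suc l - j)) m) 0"
          using o(1)[of j] even0[of j] by (cases "odd j") auto
      qed (use o(1)[of 1] m in auto)
      moreover have "coeff (coeff S1 m) n = 0" if "n > 0" for n
        unfolding S1_def coeff_sum
      proof (rule sum.neutral, intro ballI)
        fix j assume "j \<in> {1..l}"
        then show "coeff (coeff (E_poly j * E_poly (Suc l - j)) m) n = 0"
          using o(2)[of j n] even0[of j] that by (cases "odd j") auto
      qed
      ultimately show ?thesis
        unfolding rec i using E0 S20 by simp
    qed
    moreover have "coeff (coeff (E_poly k) ((k - 1) div 2)) 1 < 0" if "even k"
    proof -
      have "even l" using that 2 by simp
      then obtain m where m: "l = 2 * m" by (rule evenE)
      have i: "(k - 1) div 2 = m" using m 2 by simp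
      have E: "coeff (coeff (E_poly (Suc l)) m) 0 > 0" "coeff (coeff (E_poly (Suc l)) m) 1 = 0"
        using pos[of "Suc l"] const[of "Suc l" 1] m 2 by auto
      \<comment> \<open>Here one index is odd and the other even: a positive constant is multiplied
        by a polynomial in \<open>p\<close> with negative linear coefficient.\<close>
      have S1: "coeff (coeff S1 (m - 1)) 1 \<le> 0" if "m > 0"
        unfolding S1_def coeff_sum
      proof (rule sum_nonpos)
        have *: "coeff (coeff (E_poly a) ((a - 1) div 2) * coeff (E_poly b) ((b - 1) div 2)) 1 \<le> 0"
          if "a < k" "b < k" "odd a" "even b" "b \<ge> 1" for a b
        proof -
          have "coeff (coeff (E_poly a) ((a - 1) div 2) * coeff (E_poly b) ((b - 1) div 2)) 1
            = coeff (coeff (E_poly a) ((a - 1) div 2)) 0 * coeff (coeff (E_poly b) ((b - 1) div 2)) 1"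
            using const[of a 1] that by (simp add: coeff_mult)
          then show ?thesis using pos[of a] neg[of b] that by (simp add: mult_nonneg_nonpos)
        qed
        fix j assume j: "j \<in> {1..l}"
        have "(j - 1) div 2 + (Suc l - j - 1) div 2 = m - 1"
        proof (cases "even j")
          case True
          then obtain a where "j = 2 * a" by (rule evenE)
          then show ?thesis using j m by simp linarith
        next
          case False
          then obtain a where "j = 2 * a + 1" by (rule oddE)
          then show ?thesis using j m by simp
        qed
        then have "coeff (E_poly j * E_poly (Suc l - j)) (m - 1)
          = coeff (E_poly j) ((j - 1) div 2) * coeff (E_poly (Suc l - j)) ((Suc l - j - 1) div 2)"
          using prod_top[of j "Suc l - j"] j 2 by auto
        then show "coeff (coeff (E_poly j * E_poly (Suc l - j)) (m - 1)) 1 \<le> 0"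
          using *[of j "Suc l - j"] *[of "Suc l - j" j] j m 2
          by (cases "even j") (auto simp: mult.commute)
      qed
      \<comment> \<open>Here the indices have equal parity. Two even ones do not reach
        \<open>y ^ (m - 1)\<close>; two odd ones have constant top coefficients, whose product has
        no linear term in \<open>p\<close>.\<close>
      have S2: "coeff (coeff S2 (m - 1)) 1 = 0" if "m > 0"
        unfolding S2_def coeff_sum
      proof (rule sum.neutral, intro ballI)
        fix j assume j: "j \<in> {1..l - 1}"
        show "coeff (coeff (E_poly j * E_poly (l - j)) (m - 1)) 1 = 0"
        proof (cases "even j")
          case True
          have "degree (E_poly j * E_poly (l - j)) \<le> (j - 1) div 2 + (l - j - 1) div 2"
            using j 2 by (intro prod_deg) auto
          also have "\<dots> < m - 1"
          proof -
            obtain a where a: "j = 2 * a" using True by (rule evenE)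
            then have "j - 1 = 2 * (a - 1) + 1" "l - j - 1 = 2 * (m - 1 - a) + 1" "1 \<le> a" "a \<le> m - 1"
              using j m by auto
            then show ?thesis by simp
          qed
          finally show ?thesis by (simp add: coeff_eq_0)
        next
          case False
          then obtain a where a: "j = 2 * a + 1" by (rule oddE)
          then have "l - j - 1 = 2 * (m - 1 - a)" "a \<le> m - 1" using j m by auto
          then have "(j - 1) div 2 + (l - j - 1) div 2 = m - 1" using a by simp
          then have "coeff (E_poly j * E_poly (l - j)) (m - 1)
             = coeff (E_poly j) ((j - 1) div 2) * coeff (E_poly (l - j)) ((l - j - 1) div 2)"
            using prod_top[of j "l - j"] j 2 by auto
          moreover have "l - j < k" "odd (l - j)" "j < k" using j m 2 False by auto
          ultimately show ?thesis using const[of j 1] const[of "l - j" 1] False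
            by (simp add: coeff_mult)
        qed
      qed
      have "(if m = 0 then 0 else coeff (coeff S1 (m - 1)) 1 + coeff (coeff S2 (m - 1)) 1) \<le> 0"
        using S1 S2 by simp
      then show ?thesis
        unfolding rec i using E by (simp add: divide_less_0_iff)
    qed
    ultimately show ?thesis by blast
  qed
qed

lemma degree_E_poly:
  assumes "k \<ge> 1"
  shows "degree (E_poly k) = (k - 1) div 2"
proof (rule antisym)
  show "(k - 1) div 2 \<le> degree (E_poly k)"
    using E_poly_lead_y[OF assms] by (intro le_degree) (cases "even k"; force)
qed (use E_poly_lead_y[OF assms] in blast)

lemma degree_subst_square: "degree (subst_square q) = 2 * degree q"
  by (simp add: subst_square_def degree_pcompose degree_monom_eq)

lemma eval_py_E_poly_Suc:
  assumes "k \<ge> 1"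
  shows "(real k + 1) * eval_py (E_poly (k + 1)) p y =
    y * (\<Sum>j = 1..k - 1. eval_py (E_poly j) p y * eval_py (E_poly (k - j)) p y)
    + y * (\<Sum>j = 1..k - 2. eval_py (E_poly j) p y * eval_py (E_poly (k - 1 - j)) p y)
    - (real k + p + 1) * eval_py (E_poly k) p y"
  unfolding E_poly_rec[OF assms] eval_py_def const_py_def var_y_def var_p_def
  by (simp add: poly_sum field_simps)

section \<open>Logarithmic derivatives of entire functions of small growth\<close>

text \<open>Connects the real derivatives in \<open>beta_plus\<close> with complex ones. Along the
  real points the imaginary part of each derivative is constantly zero, so differentiating along the
  real line yields a real value again.\<close>

lemma higher_deriv_of_real:
  fixes g :: "real \<Rightarrow> real" and G :: "complex \<Rightarrow> complex"
  assumes "G holomorphic_on S" "open S" "open T"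
    and "\<And>x. x \<in> T \<Longrightarrow> of_real x \<in> S"
    and "\<And>x. x \<in> T \<Longrightarrow> G (of_real x) = of_real (g x)"
    and "x \<in> T"
  shows "(deriv ^^ k) G (of_real x) = of_real ((deriv ^^ k) g x)"
  using assms(6)
proof (induction k arbitrary: x)
  case (Suc k)
  define H where "H = (deriv ^^ k) G"
  define u where "u = (deriv ^^ k) g"
  have eq: "H (of_real y) = of_real (u y)" if "y \<in> T" for y
    using Suc.IH[OF that] by (simp add: H_def u_def)
  have "(H has_field_derivative deriv H (of_real x)) (at (of_real x))"
    using assms(1,2,4) Suc.prems unfolding H_def
    by (intro holomorphic_derivI[of _ S] holomorphic_higher_deriv) auto
  then have D: "((\<lambda>y. H (of_real y)) has_vector_derivative deriv H (of_real x)) (at x)"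
    by (intro has_vector_derivative_real_field)
  then have "((\<lambda>y. complex_of_real (u y)) has_vector_derivative deriv H (of_real x)) (at x)"
    using assms(3) Suc.prems
    by (rule has_vector_derivative_transform_within_open) (use eq in auto)
  then have 1: "((\<lambda>y. Re (complex_of_real (u y))) has_field_derivative Re (deriv H (of_real x))) (at x)"
    and 2: "((\<lambda>y. Im (complex_of_real (u y))) has_field_derivative Im (deriv H (of_real x))) (at x)"
    by (simp_all only: has_field_derivative_Re has_field_derivative_Im)
  from 1 have "deriv u x = Re (deriv H (of_real x))"
    by (simp add: DERIV_imp_deriv)
  moreover have "Im (deriv H (of_real x)) = 0"
    by (rule DERIV_unique[of "\<lambda>_. 0" _ x]) (use 2 in simp_all)
  ultimately show ?case
    by (simp add: H_def u_def complex_eq_iff)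
qed (simp add: assms(5))

section \<open>Bounds for logarithmic derivatives of functions without zeros\<close>

text \<open>The map \<open>v / (2 * A - v)\<close> sends the half plane \<open>Re v < A\<close> into
  the unit disc and fixes \<open>0\<close>, so the Schwarz lemma applies to its composition with
  \<open>g\<close>, rescaled to the unit disc.\<close>

lemma Borel_Caratheodory:
  fixes g :: "complex \<Rightarrow> complex"
  assumes hol: "g holomorphic_on ball 0 R" and "R > 0" and g0: "g 0 = 0"
    and A: "\<And>z. norm z < R \<Longrightarrow> Re (g z) < A" and z: "norm z < R"
  shows "norm (g z) * (R - norm z) \<le> 2 * A * norm z"
proof -
  have "A > 0" using A[of 0] g0 \<open>R > 0\<close> by simp
  have nz: "2 * of_real A - g u \<noteq> 0" if "norm u < R" for u
  proof
    assume "2 * of_real A - g u = 0"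
    then have "Re (2 * of_real A - g u) = 0" by simp
    then show False using A[OF that] \<open>A > 0\<close> by simp
  qed
  define \<psi> where "\<psi> = (\<lambda>u. g (of_real R * u) / (2 * of_real A - g (of_real R * u)))"
  have in_ball: "norm (of_real R * u) < R" if "norm u < 1" for u :: complex
    using that \<open>R > 0\<close> by (simp add: norm_mult)
  have hol': "(\<lambda>u. g (of_real R * u)) holomorphic_on ball 0 1"
    by (rule holomorphic_on_compose_gen[OF _ hol, unfolded o_def])
       (use in_ball in \<open>auto intro!: holomorphic_intros\<close>)
  have "\<psi> holomorphic_on ball 0 1"
    unfolding \<psi>_def by (intro holomorphic_intros hol') (use nz in_ball in auto)
  moreover have "\<psi> 0 = 0" by (simp add: \<psi>_def g0)
  moreover have "norm (\<psi> u) < 1" if "norm u < 1" for u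
  proof -
    define v where "v = g (of_real R * u)"
    have "Re v < A" using A in_ball[OF that] by (simp add: v_def)
    \<comment> \<open>This expresses that \<open>v\<close> is closer to \<open>0\<close> than to
      \<open>2 * A\<close>.\<close>
    then have "0 < 4 * A * (A - Re v)" using \<open>A > 0\<close> by simp
    also have "\<dots> = (2 * A - Re v)\<^sup>2 - (Re v)\<^sup>2"
      by (simp add: power2_eq_square algebra_simps)
    finally have "(Re v)\<^sup>2 + (Im v)\<^sup>2 < (2 * A - Re v)\<^sup>2 + (Im v)\<^sup>2" by simp
    then have "norm v < norm (2 * of_real A - v)"
      unfolding cmod_def by simp
    then show ?thesis
      unfolding \<psi>_def v_def[symmetric] norm_divide
      using norm_ge_zero[of v] by (subst divide_less_eq_1_pos) linarith+
  qed
  moreover have "norm (z / of_real R) < 1"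
    using z \<open>R > 0\<close> by (simp add: norm_divide)
  ultimately have "norm (\<psi> (z / of_real R)) \<le> norm (z / of_real R)"
    by (rule Schwarz_Lemma(1))
  then have "norm (g z) / norm (2 * of_real A - g z) \<le> norm z / R"
    using \<open>R > 0\<close> by (simp add: \<psi>_def norm_divide)
  moreover have "norm (2 * of_real A - g z) > 0" using nz[OF z] by simp
  ultimately have "norm (g z) * R \<le> norm z * norm (2 * of_real A - g z)"
    using \<open>R > 0\<close> by (simp add: divide_simps mult.commute)
  also have "\<dots> \<le> norm z * (2 * A + norm (g z))"
    using norm_triangle_ineq4[of "2 * of_real A" "g z"] \<open>A > 0\<close>
    by (intro mult_left_mono) (auto simp: norm_mult)
  finally show ?thesis by (simp add: algebra_simps)
qed

text \<open>Without zeros, \<open>h\<close> has a logarithm on the disc; normalised to vanish at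
  \<open>0\<close> it has real part below \<open>A\<close>. Borel-Caratheodory bounds it by
  \<open>2 * A\<close> on the disc of radius \<open>R / 2\<close>, and Cauchy's inequality on the
  circle of radius \<open>R / 4\<close> about \<open>w\<close> bounds its derivatives.\<close>

lemma higher_deriv_log_deriv_bound:
  fixes h :: "complex \<Rightarrow> complex"
  assumes hol: "h holomorphic_on ball 0 R" and R: "R \<ge> 4"
    and nz: "\<And>z. norm z < R \<Longrightarrow> h z \<noteq> 0"
    and A: "\<And>z. norm z < R \<Longrightarrow> norm (h z) < exp A * norm (h 0)"
    and w: "norm w \<le> R / 4"
  shows "norm ((deriv ^^ k) (\<lambda>z. deriv h z / h z) w) \<le> fact (k + 1) * (8 * A / R)"
proof -
  have "contractible (ball (0::complex) R)" by (simp add: convex_imp_contractible)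
  then obtain g0 where g0: "g0 holomorphic_on ball 0 R" "\<And>z. z \<in> ball 0 R \<Longrightarrow> h z = exp (g0 z)"
    using contractible_imp_holomorphic_log[OF hol] nz by auto
  define g where "g = (\<lambda>z. g0 z - g0 0)"
  have holg: "g holomorphic_on ball 0 R" unfolding g_def by (intro holomorphic_intros g0)
  have Re_g: "Re (g z) < A" if "norm z < R" for z
  proof -
    have "exp (Re (g z)) = norm (h z) / norm (h 0)"
      using g0(2)[of z] g0(2)[of 0] that R by (simp add: g_def exp_diff)
    also have "\<dots> < exp A" using A[OF that] nz[of 0] R by (simp add: divide_simps)
    finally show ?thesis by simp
  qed
  have "A > 0" using Re_g[of 0] R by (simp add: g_def)
  have log_deriv: "deriv h z / h z = deriv g z" if "z \<in> ball 0 R" for z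
  proof -
    have "(g0 has_field_derivative deriv g0 z) (at z)"
      using g0(1) that by (intro holomorphic_derivI) auto
    then have e: "((\<lambda>z. exp (g0 z)) has_field_derivative exp (g0 z) * deriv g0 z) (at z)"
      and g: "(g has_field_derivative deriv g0 z) (at z)"
      unfolding g_def by (auto intro!: derivative_eq_intros)
    have "(h has_field_derivative exp (g0 z) * deriv g0 z) (at z)"
      using e
      by (rule has_field_derivative_transform_within_open[of _ _ _ "ball 0 R"])
         (use g0(2) that in auto)
    then show ?thesis using g g0(2)[OF that] by (simp add: DERIV_imp_deriv[OF g] DERIV_imp_deriv)
  qed
  have wR: "w \<in> ball 0 R" using w R by auto
  have "eventually (\<lambda>z. z \<in> ball 0 R) (nhds w)"
    using wR by (intro eventually_nhds_in_open) auto
  then have "eventually (\<lambda>z. deriv h z / h z = deriv g z) (nhds w)"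
    by eventually_elim (rule log_deriv)
  then have "(deriv ^^ k) (\<lambda>z. deriv h z / h z) w = (deriv ^^ k) (deriv g) w"
    by (rule higher_deriv_cong_ev) simp
  also have "\<dots> = (deriv ^^ Suc k) g w" by (simp add: funpow_swap1)
  finally have eq: "(deriv ^^ k) (\<lambda>z. deriv h z / h z) w = (deriv ^^ (k + 1)) g w" by simp
  have sub: "cball w (R / 4) \<subseteq> cball 0 (R / 2)"
    using w R by (subst cball_subset_cball_iff) auto
  also have "\<dots> \<subseteq> ball 0 R" using R by (auto simp: subset_iff)
  finally have sub': "cball w (R / 4) \<subseteq> ball 0 R" .
  have "norm ((deriv ^^ (k + 1)) g w) \<le> fact (k + 1) * (2 * A) / (R / 4) ^ (k + 1)"
  proof (rule Cauchy_inequality)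
    show "g holomorphic_on ball w (R / 4)"
      using holg sub' by (rule holomorphic_on_subset[OF _ order_trans[OF ball_subset_cball]])
    show "continuous_on (cball w (R / 4)) g"
      using holg sub' holomorphic_on_imp_continuous_on holomorphic_on_subset by blast
    show "R / 4 > 0" using R by simp
    fix x assume "norm (w - x) = R / 4"
    then have "x \<in> cball w (R / 4)" by (simp add: dist_norm)
    then have x: "norm x \<le> R / 2" using sub by auto
    have "norm (g x) * (R / 2) \<le> norm (g x) * (R - norm x)"
      using x by (intro mult_left_mono) auto
    also have "\<dots> \<le> 2 * A * norm x"
      using holg R Re_g x by (intro Borel_Caratheodory) (auto simp: g_def)
    also have "\<dots> \<le> 2 * A * (R / 2)" using x \<open>A > 0\<close> by (intro mult_left_mono) auto
    finally show "norm (g x) \<le> 2 * A" using R by simp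
  qed
  also have "\<dots> \<le> fact (k + 1) * (2 * A) / (R / 4)"
  proof (rule divide_left_mono)
    show "R / 4 \<le> (R / 4) ^ (k + 1)" using R by (intro self_le_power) auto
    show "0 < (R / 4) ^ (k + 1) * (R / 4)" using R by simp
    show "0 \<le> fact (k + 1) * (2 * A)" using \<open>A > 0\<close> by (simp del: fact_Suc)
  qed
  finally show ?thesis unfolding eq by (simp add: mult_ac)
qed

section \<open>Dividing out zeros of entire functions\<close>

text \<open>The zeros are divided out one at a time. If the quotient still vanished at some
  \<open>a\<close> in \<open>Z\<close>, both factors of \<open>f\<close> would vanish there and
  \<open>deriv f a\<close> would be zero.\<close>

lemma factor_simple_zeros:
  fixes f :: "complex \<Rightarrow> complex"
  assumes "finite Z" "f holomorphic_on UNIV"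
    and "\<And>a. a \<in> Z \<Longrightarrow> f a = 0 \<and> deriv f a \<noteq> 0 \<and> a \<noteq> 0"
  shows "\<exists>h. h holomorphic_on UNIV \<and> (\<forall>z. f z = h z * (\<Prod>a\<in>Z. 1 - z / a)) \<and> (\<forall>a\<in>Z. h a \<noteq> 0)"
  using assms(1,3)
proof (induction Z)
  case empty
  then show ?case using assms(2) by auto
next
  case (insert b Z)
  then obtain h where h: "h holomorphic_on UNIV" "\<And>z. f z = h z * (\<Prod>a\<in>Z. 1 - z / a)"
    by blast
  have Z0: "a \<noteq> 0" if "a \<in> insert b Z" for a using insert.prems that by blast
  have "(\<Prod>a\<in>Z. 1 - b / a) \<noteq> 0" using insert.hyps Z0 by (auto simp: divide_simps)
  then have hb: "h b = 0" using h(2)[of b] insert.prems by auto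
  \<comment> \<open>The difference quotient of \<open>h\<close> at \<open>b\<close>, with its
    removable singularity filled in; the factor \<open>- b\<close> reflects
    \<open>z - b = - b * (1 - z / b)\<close>.\<close>
  define h1 where "h1 = (\<lambda>z. - b * (if z = b then deriv h b else (h z - h b) / (z - b)))"
  have hol: "h1 holomorphic_on UNIV"
    unfolding h1_def by (intro holomorphic_intros pole_lemma h(1)) auto
  have h1: "h z = h1 z * (1 - z / b)" for z
    using hb Z0[of b] by (auto simp: h1_def divide_simps) (simp add: algebra_simps)
  have eq: "f z = h1 z * (\<Prod>a\<in>insert b Z. 1 - z / a)" for z
    using h(2)[of z] h1[of z] insert.hyps by simp
  have "h1 a \<noteq> 0" if a: "a \<in> insert b Z" for a
  proof
    assume 0: "h1 a = 0"
    have P0: "(\<Prod>c\<in>insert b Z. 1 - a / c) = 0"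
      using a insert.hyps Z0[OF a] by (intro prod_zero) auto
    have "(\<lambda>z. \<Prod>c\<in>insert b Z. 1 - z / c) holomorphic_on UNIV"
      using Z0 by (intro holomorphic_intros) auto
    then have "((\<lambda>z. h1 z * (\<Prod>c\<in>insert b Z. 1 - z / c)) has_field_derivative
        deriv h1 a * (\<Prod>c\<in>insert b Z. 1 - a / c) + deriv (\<lambda>z. \<Prod>c\<in>insert b Z. 1 - z / c) a * h1 a) (at a)"
      using hol by (intro DERIV_mult holomorphic_derivI) auto
    then have "(f has_field_derivative 0) (at a)"
      unfolding 0 P0 eq[abs_def] by simp
    then show False using insert.prems[OF a] by (simp add: DERIV_imp_deriv)
  qed
  with hol eq show ?case by blast
qed

lemma higher_deriv_inverse_diff:
  fixes a w :: complex
  assumes "w \<noteq> a"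
  shows "(deriv ^^ k) (\<lambda>z. 1 / (a - z)) w = fact k / (a - w) ^ (k + 1)"
  using assms
proof (induction k arbitrary: w)
  case (Suc k)
  have "eventually (\<lambda>z. z \<in> - {a}) (nhds w)"
    using Suc.prems by (intro eventually_nhds_in_open) auto
  then have "eventually (\<lambda>z. (deriv ^^ k) (\<lambda>z. 1 / (a - z)) z = fact k / (a - z) ^ (k + 1)) (nhds w)"
    by eventually_elim (use Suc.IH in auto)
  then have "deriv ((deriv ^^ k) (\<lambda>z. 1 / (a - z))) w = deriv (\<lambda>z. fact k / (a - z) ^ (k + 1)) w"
    by (rule deriv_cong_ev) simp
  also have "\<dots> = fact (k + 1) / (a - w) ^ (k + 2)"
  proof (rule DERIV_imp_deriv)
    have "((\<lambda>z. fact k / (a - z) ^ (k + 1)) has_field_derivative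
        (0 * (a - w) ^ (k + 1) - fact k * (of_nat (k + 1) * (a - w) ^ k * (0 - 1)))
          / ((a - w) ^ (k + 1) * (a - w) ^ (k + 1))) (at w)"
      using Suc.prems by (intro derivative_eq_intros refl) auto
    also have "(0 * (a - w) ^ (k + 1) - fact k * (of_nat (k + 1) * (a - w) ^ k * (0 - 1)))
          / ((a - w) ^ (k + 1) * (a - w) ^ (k + 1)) = fact (k + 1) / (a - w) ^ (k + 2)"
    proof -
      have "(0 * d ^ (k + 1) - fact k * (of_nat (k + 1) * d ^ k * (0 - 1))) / (d ^ (k + 1) * d ^ (k + 1))
          = fact (k + 1) / d ^ (k + 2)" if "d \<noteq> 0" for d :: complex
        using that by (simp add: field_simps)
      then show ?thesis using Suc.prems by simp
    qed
    finally show "((\<lambda>z. fact k / (a - z) ^ (k + 1)) has_field_derivative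
        fact (k + 1) / (a - w) ^ (k + 2)) (at w)" .
  qed
  finally show ?case by simp
qed simp

lemma higher_deriv_sum:
  fixes f :: "'a \<Rightarrow> complex \<Rightarrow> complex"
  assumes "finite I" "\<And>i. i \<in> I \<Longrightarrow> f i holomorphic_on S" "open S" "w \<in> S"
  shows "(deriv ^^ k) (\<lambda>z. \<Sum>i\<in>I. f i z) w = (\<Sum>i\<in>I. (deriv ^^ k) (f i) w)"
  using assms(1,2)
proof (induction I)
  case (insert i I)
  have "(deriv ^^ k) (\<lambda>z. \<Sum>j\<in>insert i I. f j z) w = (deriv ^^ k) (\<lambda>z. f i z + (\<Sum>j\<in>I. f j z)) w"
    using insert.hyps by simp
  also have "\<dots> = (deriv ^^ k) (f i) w + (deriv ^^ k) (\<lambda>z. \<Sum>j\<in>I. f j z) w"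
    using insert.prems assms(3,4) by (intro higher_deriv_add[of _ S]) (auto intro!: holomorphic_intros)
  finally show ?case using insert by simp
qed simp


lemma quotient_bound:
  fixes f h :: "complex \<Rightarrow> complex"
  assumes h: "h holomorphic_on UNIV" "\<And>z. f z = h z * (\<Prod>a\<in>Z. 1 - z / a)"
    and Z: "\<And>a. a \<in> Z \<Longrightarrow> a \<noteq> 0 \<and> norm a \<le> R" and "R > 0"
    and M: "\<And>z. norm z = 2 * R \<Longrightarrow> norm (f z) \<le> M" and z: "norm z \<le> 2 * R"
  shows "norm (h z) \<le> M"
proof (rule maximum_modulus_frontier[of h "cball 0 (2 * R)"])
  show "h holomorphic_on interior (cball 0 (2 * R))" "continuous_on (closure (cball 0 (2 * R))) h"
    using h(1) holomorphic_on_subset holomorphic_on_imp_continuous_on by blast+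
  fix u :: complex assume "u \<in> frontier (cball 0 (2 * R))"
  then have u: "norm u = 2 * R" by simp
  have "1 \<le> norm (1 - u / a)" if "a \<in> Z" for a
  proof -
    have "2 * norm a \<le> norm u" "norm a > 0" using Z[OF that] u by auto
    then have "2 \<le> norm (u / a)" by (simp add: norm_divide divide_simps)
    then show ?thesis using norm_triangle_ineq2[of "u / a" 1] by (simp add: norm_minus_commute)
  qed
  then have "1 \<le> norm (\<Prod>a\<in>Z. 1 - u / a)"
    unfolding prod_norm[symmetric] by (intro prod_ge_1)
  then have "norm (h u) \<le> norm (f u)"
    unfolding h(2)[of u] norm_mult by (simp add: mult_le_cancel_left1)
  with M[OF u] show "norm (h u) \<le> M" by simp
qed (use z in auto)

text \<open>The radius \<open>R0\<close> does not depend on \<open>Z\<close> and \<open>h\<close>.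
  This serves both a fixed quotient by finitely many zeros and quotients that change with the
  growing disc.\<close>

lemma higher_deriv_log_deriv_quotient_small:
  fixes f :: "complex \<Rightarrow> complex"
  assumes f0: "f 0 \<noteq> 0"
    and growth: "\<forall>\<epsilon>>0. \<exists>C. \<forall>z. norm (f z) \<le> C * exp (\<epsilon> * norm z)"
    and "\<delta> > 0"
  shows "\<exists>R0. \<forall>R\<ge>R0. \<forall>Z h. finite Z \<and> (\<forall>a\<in>Z. a \<noteq> 0 \<and> norm a \<le> R) \<and>
    h holomorphic_on UNIV \<and> (\<forall>z. f z = h z * (\<Prod>a\<in>Z. 1 - z / a)) \<and>
    (\<forall>z. norm z < R \<longrightarrow> h z \<noteq> 0) \<longrightarrow> norm ((deriv ^^ k) (\<lambda>z. deriv h z / h z) w) \<le> \<delta>"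
proof -
  \<comment> \<open>With \<open>A = K + 2 * e * R\<close> the bound
    \<open>fact (k + 1) * (8 * A / R)\<close> splits into two summands. This \<open>e\<close> makes
    the one without \<open>R\<close> equal to \<open>\<delta> / 2\<close>; the last entry of
    \<open>R0\<close> below does the same, as an upper bound, for the one with
    \<open>K / R\<close>.\<close>
  define e where "e = \<delta> / (32 * fact (k + 1))"
  have e: "e > 0" using \<open>\<delta> > 0\<close> by (simp add: e_def)
  then obtain C where C: "\<And>z. norm (f z) \<le> C * exp (e * norm z)" using growth by blast
  have "0 < norm (f 0)" using f0 by simp
  also have "\<dots> \<le> C" using C[of 0] by simp
  finally have C0: "C > 0" .
  \<comment> \<open>The added \<open>1\<close> provides the strict inequality
    \<open>C < exp K * norm (f 0)\<close>.\<close>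
  define K where "K = \<bar>ln (C / norm (f 0))\<bar> + 1"
  define R0 where "R0 = max (max 4 (4 * norm w)) (16 * fact (k + 1) * K / \<delta>)"
  show ?thesis
  proof (intro exI[of _ R0] allI impI, elim conjE)
    fix R Z h
    assume R: "R0 \<le> R" and "finite Z" and Z: "\<forall>a\<in>Z. a \<noteq> 0 \<and> norm a \<le> R"
      and hol: "h holomorphic_on UNIV" and fh: "\<forall>z. f z = h z * (\<Prod>a\<in>Z. 1 - z / a)"
      and nz: "\<forall>z. norm z < R \<longrightarrow> h z \<noteq> 0"
    have R4: "R \<ge> 4" "norm w \<le> R / 4" "16 * fact (k + 1) * K / \<delta> \<le> R"
      using R by (auto simp: R0_def)
    have h0: "h 0 = f 0" using fh by simp
    define A where "A = K + 2 * e * R"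
    have "norm (h z) < exp A * norm (h 0)" if "norm z < R" for z
    proof -
      have "norm (h z) \<le> C * exp (e * (2 * R))"
      proof (rule quotient_bound[OF hol])
        show "norm (f z) \<le> C * exp (e * (2 * R))" if "norm z = 2 * R" for z
          using C[of z] that by simp
      qed (use fh Z R4 that in auto)
      also have "C < exp K * norm (f 0)"
      proof -
        have "ln (C / norm (f 0)) < K" by (simp add: K_def)
        then have "C / norm (f 0) < exp K" using C0 f0
          by (metis divide_pos_pos exp_less_mono exp_ln zero_less_norm_iff)
        then show ?thesis using f0 by (simp add: divide_simps)
      qed
      then have "C * exp (e * (2 * R)) < exp K * norm (f 0) * exp (e * (2 * R))"
        by simp
      also have "\<dots> = exp A * norm (h 0)"
        by (simp add: A_def h0 exp_add mult_ac)
      finally show ?thesis .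
    qed
    then have "norm ((deriv ^^ k) (\<lambda>z. deriv h z / h z) w) \<le> fact (k + 1) * (8 * A / R)"
      using R4 nz hol by (intro higher_deriv_log_deriv_bound holomorphic_on_subset[OF hol]) auto
    also have "\<dots> = 8 * fact (k + 1) * K / R + 16 * fact (k + 1) * e"
      using R4(1) by (simp add: A_def field_simps del: fact_Suc)
    also have "16 * fact (k + 1) * e = \<delta> / 2" by (simp add: e_def del: fact_Suc)
    also have "8 * fact (k + 1) * K / R \<le> \<delta> / 2"
    proof -
      have "16 * fact (k + 1) * K \<le> R * \<delta>"
        using R4(3) \<open>\<delta> > 0\<close> by (simp only: pos_divide_le_eq)
      then have "8 * fact (k + 1) * K \<le> \<delta> / 2 * R" by (simp del: fact_Suc add: mult.commute)
      then show ?thesis using R4(1) by (subst pos_divide_le_eq) auto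
    qed
    finally show "norm ((deriv ^^ k) (\<lambda>z. deriv h z / h z) w) \<le> \<delta>" by simp
  qed
qed

text \<open>The quotient by all zeros has no zeros in any disc, so its logarithmic derivative is
  below every bound, hence zero, and the quotient is constant.\<close>

lemma entire_finite_zeros_imp_poly:
  fixes f :: "complex \<Rightarrow> complex"
  assumes f: "f holomorphic_on UNIV" "f 0 \<noteq> 0"
    and growth: "\<forall>\<epsilon>>0. \<exists>C. \<forall>z. norm (f z) \<le> C * exp (\<epsilon> * norm z)"
    and simple: "\<And>a. f a = 0 \<Longrightarrow> deriv f a \<noteq> 0"
    and fin: "finite {a. f a = 0}"
  shows "\<exists>p. \<forall>z. f z = poly p z"
proof -
  define Z where "Z = {a. f a = 0}"
  have finZ: "finite Z" using fin by (simp add: Z_def)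
  have Z0: "a \<noteq> 0" if "a \<in> Z" for a using f(2) that by (auto simp: Z_def)
  have "\<And>a. a \<in> Z \<Longrightarrow> f a = 0 \<and> deriv f a \<noteq> 0 \<and> a \<noteq> 0"
    using simple f(2) by (auto simp: Z_def)
  then obtain h where h: "h holomorphic_on UNIV" "\<And>z. f z = h z * (\<Prod>a\<in>Z. 1 - z / a)"
      "\<And>a. a \<in> Z \<Longrightarrow> h a \<noteq> 0"
    using factor_simple_zeros[OF finZ f(1)] by blast
  have hnz: "h z \<noteq> 0" for z
    using h(2)[of z] h(3)[of z] by (cases "z \<in> Z") (auto simp: Z_def)
  obtain B where B: "\<And>a. a \<in> Z \<Longrightarrow> norm a \<le> B"
    using finite_imp_bounded[OF finZ] by (auto simp: bounded_iff)
  have "deriv h w = 0" for w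
  proof -
    have "norm (deriv h w / h w) \<le> \<delta>" if \<delta>: "\<delta> > 0" for \<delta>
    proof -
      obtain R0 where R0: "\<forall>R\<ge>R0. \<forall>Z h. finite Z \<and> (\<forall>a\<in>Z. a \<noteq> 0 \<and> norm a \<le> R) \<and>
    h holomorphic_on UNIV \<and> (\<forall>z. f z = h z * (\<Prod>a\<in>Z. 1 - z / a)) \<and>
    (\<forall>z. norm z < R \<longrightarrow> h z \<noteq> 0) \<longrightarrow> norm ((deriv ^^ 0) (\<lambda>z. deriv h z / h z) w) \<le> \<delta>"
        using higher_deriv_log_deriv_quotient_small[OF f(2) growth \<delta>] by (rule exE)
      have "finite Z \<and> (\<forall>a\<in>Z. a \<noteq> 0 \<and> norm a \<le> max R0 B) \<and> h holomorphic_on UNIV \<and>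
          (\<forall>z. f z = h z * (\<Prod>a\<in>Z. 1 - z / a)) \<and> (\<forall>z. norm z < max R0 B \<longrightarrow> h z \<noteq> 0)"
        using finZ Z0 h(1,2) hnz order_trans[OF B max.cobounded2] by blast
      from R0[rule_format, OF max.cobounded1 this] show ?thesis by simp
    qed
    then have "norm (deriv h w / h w) \<le> 0" by (rule field_le_epsilon) simp
    then show ?thesis using hnz[of w] by simp
  qed
  then have "(h has_field_derivative 0) (at z)" for z
    using holomorphic_derivI[OF h(1) open_UNIV, of z] by simp
  then have "\<exists>c. \<forall>z\<in>UNIV. h z = c"
    by (intro has_field_derivative_zero_constant) auto
  then obtain c where c: "\<And>z. h z = c" by auto
  have "f z = poly (smult c (\<Prod>a\<in>Z. [:1, - (1 / a):])) z" for z
    by (simp add: h(2) c poly_prod)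
  then show ?thesis by blast
qed

text \<open>Dividing out the zeros in a disc gives
  \<open>- f' / f = (\<Sum>a\<in>Z. 1 / (a - z)) - h' / h\<close>, and the derivatives of the last
  term tend to zero. Only convergence along growing discs is obtained here; summability is
  established separately.\<close>

lemma sum_zeros_tendsto_higher_deriv:
  fixes f :: "complex \<Rightarrow> complex"
  assumes f: "f holomorphic_on UNIV" "f 0 \<noteq> 0"
    and growth: "\<forall>\<epsilon>>0. \<exists>C. \<forall>z. norm (f z) \<le> C * exp (\<epsilon> * norm z)"
    and simple: "\<And>a. f a = 0 \<Longrightarrow> deriv f a \<noteq> 0"
    and fin: "\<And>R. finite {a. f a = 0 \<and> norm a \<le> R}"
    and w: "f w \<noteq> 0"
  shows "((\<lambda>R. \<Sum>a | f a = 0 \<and> norm a \<le> R. 1 / (a - w) ^ (k + 1)) \<longlongrightarrow>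
    (deriv ^^ k) (\<lambda>z. - deriv f z / f z) w / fact k) at_top"
proof (rule tendstoI)
  fix \<delta>0 :: real assume "\<delta>0 > 0"
  define \<delta> where "\<delta> = \<delta>0 / 2"
  have \<delta>: "\<delta> > 0" using \<open>\<delta>0 > 0\<close> by (simp add: \<delta>_def)
  obtain R0 where R0: "\<forall>R\<ge>R0. \<forall>Z h. finite Z \<and> (\<forall>a\<in>Z. a \<noteq> 0 \<and> norm a \<le> R) \<and>
    h holomorphic_on UNIV \<and> (\<forall>z. f z = h z * (\<Prod>a\<in>Z. 1 - z / a)) \<and>
    (\<forall>z. norm z < R \<longrightarrow> h z \<noteq> 0) \<longrightarrow> norm ((deriv ^^ k) (\<lambda>z. deriv h z / h z) w) \<le> \<delta>"
        using higher_deriv_log_deriv_quotient_small[OF f(2) growth \<delta>] by (rule exE)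
  define S where "S = {z. f z \<noteq> 0}"
  have openS: "open S"
    unfolding S_def using f(1) by (intro open_Collect_neq holomorphic_on_imp_continuous_on) auto
  have wS: "w \<in> S" using w by (simp add: S_def)
  have "dist (\<Sum>a | f a = 0 \<and> norm a \<le> R. 1 / (a - w) ^ (k + 1))
      ((deriv ^^ k) (\<lambda>z. - deriv f z / f z) w / fact k) < \<delta>0" if R: "R \<ge> R0" for R
  proof -
    define Z where "Z = {a. f a = 0 \<and> norm a \<le> R}"
    have finZ: "finite Z" using fin by (simp add: Z_def)
    have ZR: "norm a \<le> R" if "a \<in> Z" for a using that by (simp add: Z_def)
    have Z0: "a \<noteq> 0" if "a \<in> Z" for a using f(2) that by (auto simp: Z_def)
    have "\<And>a. a \<in> Z \<Longrightarrow> f a = 0 \<and> deriv f a \<noteq> 0 \<and> a \<noteq> 0"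
      using simple f(2) by (auto simp: Z_def)
    then obtain h where h: "h holomorphic_on UNIV" "\<And>z. f z = h z * (\<Prod>a\<in>Z. 1 - z / a)"
        "\<And>a. a \<in> Z \<Longrightarrow> h a \<noteq> 0"
      using factor_simple_zeros[OF finZ f(1)] by blast
    have hnz: "h z \<noteq> 0" if "norm z < R" for z
      using h(2)[of z] h(3)[of z] that by (cases "z \<in> Z") (auto simp: Z_def)
    \<comment> \<open>This covers all of \<open>S\<close>, so the position of \<open>w\<close>
      relative to the disc does not matter.\<close>
    have hS: "h z \<noteq> 0" if "z \<in> S" for z using h(2)[of z] that by (auto simp: S_def)
    have small: "norm ((deriv ^^ k) (\<lambda>z. deriv h z / h z) w) \<le> \<delta>"
    proof -
      have "finite Z \<and> (\<forall>a\<in>Z. a \<noteq> 0 \<and> norm a \<le> R) \<and> h holomorphic_on UNIV \<and>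
          (\<forall>z. f z = h z * (\<Prod>a\<in>Z. 1 - z / a)) \<and> (\<forall>z. norm z < R \<longrightarrow> h z \<noteq> 0)"
        using finZ Z0 h(1,2) hnz ZR by blast
      from R0[rule_format, OF R this] show ?thesis .
    qed
    have SZ: "z \<noteq> a" if "z \<in> S" "a \<in> Z" for z a using that by (auto simp: S_def Z_def)
    have log_deriv: "- deriv f z / f z = (\<Sum>a\<in>Z. 1 / (a - z)) - deriv h z / h z" if z: "z \<in> S" for z
    proof -
      have fac: "1 - z / a \<noteq> 0" if "a \<in> Z" for a
        using SZ[OF z that] Z0[OF that] by (simp add: divide_simps)
      have "((\<lambda>z. \<Prod>a\<in>Z. 1 - z / a) has_field_derivative
          (\<Prod>a\<in>Z. 1 - z / a) * (\<Sum>a\<in>Z. (0 - 1 / a) / (1 - z / a))) (at z)"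
        using fac Z0 by (intro has_field_derivative_prod') (auto intro!: derivative_eq_intros)
      also have "(\<Sum>a\<in>Z. (0 - 1 / a) / (1 - z / a)) = - (\<Sum>a\<in>Z. 1 / (a - z))"
        unfolding sum_negf[symmetric] using SZ[OF z] Z0
        by (intro sum.cong refl) (simp add: divide_simps)
      finally have P: "((\<lambda>z. \<Prod>a\<in>Z. 1 - z / a) has_field_derivative
          (\<Prod>a\<in>Z. 1 - z / a) * - (\<Sum>a\<in>Z. 1 / (a - z))) (at z)" .
      have "(h has_field_derivative deriv h z) (at z)"
        using h(1) by (intro holomorphic_derivI) auto
      from DERIV_mult[OF this P] have "deriv f z = deriv h z * (\<Prod>a\<in>Z. 1 - z / a)
          + (\<Prod>a\<in>Z. 1 - z / a) * - (\<Sum>a\<in>Z. 1 / (a - z)) * h z"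
        unfolding h(2)[abs_def] by (rule DERIV_imp_deriv)
      moreover have "(\<Prod>a\<in>Z. 1 - z / a) \<noteq> 0"
        unfolding prod_zero_iff[OF finZ] using fac by blast
      ultimately show ?thesis
        using hS[OF z] unfolding h(2)[of z] by (simp add: field_simps)
    qed
    have "eventually (\<lambda>z. z \<in> S) (nhds w)"
      using openS wS by (rule eventually_nhds_in_open)
    then have "eventually (\<lambda>z. - deriv f z / f z = (\<Sum>a\<in>Z. 1 / (a - z)) - deriv h z / h z) (nhds w)"
      by eventually_elim (rule log_deriv)
    then have "(deriv ^^ k) (\<lambda>z. - deriv f z / f z) w
        = (deriv ^^ k) (\<lambda>z. (\<Sum>a\<in>Z. 1 / (a - z)) - deriv h z / h z) w"
      by (rule higher_deriv_cong_ev) simp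
    also have "\<dots> = (deriv ^^ k) (\<lambda>z. \<Sum>a\<in>Z. 1 / (a - z)) w - (deriv ^^ k) (\<lambda>z. deriv h z / h z) w"
    proof (rule higher_deriv_diff[OF _ _ openS wS])
      show "(\<lambda>z. \<Sum>a\<in>Z. 1 / (a - z)) holomorphic_on S"
        using SZ by (intro holomorphic_intros) auto
      show "(\<lambda>z. deriv h z / h z) holomorphic_on S"
        using hS holomorphic_on_subset[OF h(1) subset_UNIV]
          holomorphic_on_subset[OF holomorphic_deriv[OF h(1) open_UNIV] subset_UNIV]
        by (intro holomorphic_on_divide)
    qed
    also have "(deriv ^^ k) (\<lambda>z. \<Sum>a\<in>Z. 1 / (a - z)) w = (\<Sum>a\<in>Z. (deriv ^^ k) (\<lambda>z. 1 / (a - z)) w)"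
      using SZ by (intro higher_deriv_sum[OF finZ _ openS wS] holomorphic_intros) auto
    also have "\<dots> = fact k * (\<Sum>a\<in>Z. 1 / (a - w) ^ (k + 1))"
      unfolding sum_distrib_left using SZ[OF wS]
      by (intro sum.cong refl) (simp add: higher_deriv_inverse_diff del: power_Suc)
    finally have "(\<Sum>a\<in>Z. 1 / (a - w) ^ (k + 1)) - (deriv ^^ k) (\<lambda>z. - deriv f z / f z) w / fact k
        = (deriv ^^ k) (\<lambda>z. deriv h z / h z) w / fact k"
      by (simp add: divide_simps)
    then have "dist (\<Sum>a\<in>Z. 1 / (a - w) ^ (k + 1)) ((deriv ^^ k) (\<lambda>z. - deriv f z / f z) w / fact k)
        = norm ((deriv ^^ k) (\<lambda>z. deriv h z / h z) w) / fact k"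
      by (simp add: dist_norm norm_divide)
    also have "\<dots> \<le> norm ((deriv ^^ k) (\<lambda>z. deriv h z / h z) w) / 1"
      by (intro divide_left_mono) auto
    also have "\<dots> < \<delta>0" using small \<open>\<delta>0 > 0\<close> by (simp add: \<delta>_def)
    finally show ?thesis by (simp add: Z_def)
  qed
  then show "\<forall>\<^sub>F R in at_top. dist (\<Sum>a | f a = 0 \<and> norm a \<le> R. 1 / (a - w) ^ (k + 1))
      ((deriv ^^ k) (\<lambda>z. - deriv f z / f z) w / fact k) < \<delta>0"
    unfolding eventually_at_top_linorder by blast
qed

section \<open>The entire function of Bessel\<close>

text \<open>Coefficients of \<open>F\<^sub>p\<close> in the variable \<open>x\<^sup>2\<close>; the
  power of \<open>4\<close> comes from \<open>(x / 2) ^ (2 * k)\<close>. Up to the factor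
  \<open>1 / Gamma (p + 1)\<close> the series is the hypergeometric function 0F1 with parameter
  \<open>p + 1\<close> at \<open>- z / 4\<close>.\<close>

definition bessel_coeff :: "real \<Rightarrow> nat \<Rightarrow> real" where
  "bessel_coeff p k = (-1) ^ k / (4 ^ k * fact k * Gamma (p + real k + 1))"

definition bessel_entire :: "real \<Rightarrow> complex \<Rightarrow> complex" where
  "bessel_entire p z = (\<Sum>k. of_real (bessel_coeff p k) * z ^ k)"

lemma Gamma_shift:
  assumes "p > -1"
  shows "Gamma (p + real k + 2) = (p + real k + 1) * Gamma (p + real k + 1)"
proof -
  have "p + real k + 1 > 0" using assms by simp
  then have "p + real k + 1 \<notin> \<int>\<^sub>\<le>\<^sub>0" by (auto elim!: nonpos_Ints_cases)
  from Gamma_plus1[OF this] show ?thesis by (simp add: add_ac)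
qed

text \<open>Scaled by \<open>fact k / \<epsilon> ^ k\<close>, the absolute values become terms of a
  series that converges by the ratio test, because \<open>Gamma\<close> outgrows every geometric
  sequence. Comparison with the exponential series then bounds \<open>F\<^sub>p\<close> by
  exponentials of arbitrarily small rate.\<close>

lemma bessel_coeff_bound:
  assumes "p > -1" "\<epsilon> > 0"
  obtains C where "C > 0" "\<And>k. \<bar>bessel_coeff p k\<bar> \<le> C * \<epsilon> ^ k / fact k"
proof -
  define s where "s = (\<lambda>k. (1 / (4 * \<epsilon>)) ^ k / Gamma (p + real k + 1))"
  have Gpos: "Gamma (p + real k + 1) > 0" for k using assms by (intro Gamma_real_pos) simp
  \<comment> \<open>From this index on \<open>p + n + 1 >= 1 / (2 * \<epsilon>)\<close>, so the
    ratio of successive terms is at most \<open>1 / 2\<close>.\<close>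
  obtain N :: nat where N: "1 / (2 * \<epsilon>) < real N" using reals_Archimedean2 by blast
  have "summable s"
  proof (rule summable_ratio_test[of "1/2" N])
    fix n assume "n \<ge> N"
    then have "1 / (2 * \<epsilon>) \<le> p + real n + 1" using N assms(1) by linarith
    then have 1: "1 / (4 * \<epsilon>) / (p + real n + 1) \<le> 1 / 2"
    proof (subst pos_divide_le_eq)
      show "1 / (4 * \<epsilon>) \<le> 1 / 2 * (p + real n + 1)"
        using \<open>1 / (2 * \<epsilon>) \<le> p + real n + 1\<close> by (simp add: field_simps)
    qed (use assms in simp)
    have "s (Suc n) = (1 / (4 * \<epsilon>) / (p + real n + 1)) * s n"
      using Gamma_shift[OF assms(1), of n] by (simp add: s_def add_ac)
    moreover have "s n > 0" using Gpos assms by (simp add: s_def)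
    moreover have "p + real n + 1 > 0" using assms by simp
    ultimately show "norm (s (Suc n)) \<le> 1 / 2 * norm (s n)"
      using 1 assms by (simp only: norm_mult) (intro mult_right_mono, auto)
  qed simp
  then obtain C where C: "C > 0" "\<And>k. norm (s k) \<le> C"
    using summable_imp_Bseq unfolding Bseq_def by blast
  show ?thesis
  proof (rule that[of C])
    fix k
    have "s k = \<bar>bessel_coeff p k\<bar> * fact k / \<epsilon> ^ k"
      using Gpos[of k] assms by (simp add: s_def bessel_coeff_def abs_mult power_divide power_mult_distrib abs_div)
    moreover have "s k \<le> C" using C(2)[of k] by simp
    ultimately have "\<bar>bessel_coeff p k\<bar> * fact k / \<epsilon> ^ k \<le> C" by simp
    then show "\<bar>bessel_coeff p k\<bar> \<le> C * \<epsilon> ^ k / fact k"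
      using assms by (simp add: pos_divide_le_eq pos_le_divide_eq)
  qed (rule C)
qed

lemma summable_bessel_entire:
  fixes z :: complex
  assumes "p > -1"
  shows "summable (\<lambda>k. of_real (bessel_coeff p k) * z ^ k)"
proof -
  obtain C where C: "C > 0" "\<And>k. \<bar>bessel_coeff p k\<bar> \<le> C * 1 ^ k / fact k"
    using bessel_coeff_bound[OF assms zero_less_one] by metis
  have "summable (\<lambda>k. C * (inverse (fact k) * norm z ^ k))"
    by (intro summable_mult summable_exp)
  then show ?thesis
  proof (rule summable_comparison_test'[of _ 0])
    fix k :: nat
    have "\<bar>bessel_coeff p k\<bar> * norm z ^ k \<le> C * 1 ^ k / fact k * norm z ^ k"
      by (intro mult_right_mono C) simp
    then show "norm (of_real (bessel_coeff p k) * z ^ k) \<le> C * (inverse (fact k) * norm z ^ k)"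
      by (simp add: norm_mult norm_power divide_inverse mult_ac)
  qed
qed

lemma bessel_entire_growth:
  assumes "p > -1"
  shows "\<forall>\<epsilon>>0. \<exists>C. \<forall>z. norm (bessel_entire p z) \<le> C * exp (\<epsilon> * norm z)"
proof (intro allI impI)
  fix \<epsilon> :: real assume "\<epsilon> > 0"
  then obtain C where C: "C > 0" "\<And>k. \<bar>bessel_coeff p k\<bar> \<le> C * \<epsilon> ^ k / fact k"
    using bessel_coeff_bound[OF assms] by metis
  have "norm (bessel_entire p z) \<le> C * exp (\<epsilon> * norm z)" for z
  proof -
    have le: "norm (of_real (bessel_coeff p k) * z ^ k) \<le> C * (inverse (fact k) * (\<epsilon> * norm z) ^ k)" for k
    proof -
      have "\<bar>bessel_coeff p k\<bar> * norm z ^ k \<le> C * \<epsilon> ^ k / fact k * norm z ^ k"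
        by (intro mult_right_mono C) simp
      then show ?thesis
        by (simp add: norm_mult norm_power divide_inverse mult_ac power_mult_distrib)
    qed
    have sums: "(\<lambda>k. C * (inverse (fact k) * (\<epsilon> * norm z) ^ k)) sums (C * exp (\<epsilon> * norm z))"
      using exp_converges[of "\<epsilon> * norm z"] by (intro sums_mult) (simp add: divide_inverse mult.commute)
    have "norm (bessel_entire p z) \<le> (\<Sum>k. C * (inverse (fact k) * (\<epsilon> * norm z) ^ k))"
      unfolding bessel_entire_def by (rule norm_suminf_le[OF le sums_summable[OF sums]])
    then show ?thesis using sums_unique[OF sums] by simp
  qed
  then show "\<exists>C. \<forall>z. norm (bessel_entire p z) \<le> C * exp (\<epsilon> * norm z)" by blast
qed

lemma bessel_coeff_Suc: "of_nat (Suc k) * bessel_coeff p (Suc k) = - bessel_coeff (p + 1) k / 4"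
  by (simp add: bessel_coeff_def add_ac divide_simps)

lemma bessel_coeff_shift:
  assumes "p > -1"
  shows "bessel_coeff p k = (p + 1 + real k) * bessel_coeff (p + 1) k"
proof -
  have "p + 1 + real k \<noteq> 0" using assms by simp
  then show ?thesis
    using Gamma_shift[OF assms, of k] by (simp add: bessel_coeff_def add_ac)
qed

lemma diffs_bessel_coeff:
  "diffs (\<lambda>k. complex_of_real (bessel_coeff p k)) = (\<lambda>k. - (1 / 4) * of_real (bessel_coeff (p + 1) k))"
proof
  fix k
  have "diffs (\<lambda>k. complex_of_real (bessel_coeff p k)) k = of_real (of_nat (Suc k) * bessel_coeff p (Suc k))"
    by (simp add: diffs_def)
  then show "diffs (\<lambda>k. complex_of_real (bessel_coeff p k)) k = - (1 / 4) * of_real (bessel_coeff (p + 1) k)"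
    unfolding bessel_coeff_Suc by simp
qed

lemma has_field_derivative_bessel_entire:
  assumes "p > -1"
  shows "(bessel_entire p has_field_derivative - (1 / 4) * bessel_entire (p + 1) z) (at z)"
proof -
  have "(bessel_entire p has_field_derivative
      (\<Sum>k. diffs (\<lambda>k. complex_of_real (bessel_coeff p k)) k * z ^ k)) (at z)"
    unfolding bessel_entire_def[abs_def]
    by (rule termdiffs_strong_converges_everywhere) (rule summable_bessel_entire[OF assms])
  also have "(\<Sum>k. diffs (\<lambda>k. complex_of_real (bessel_coeff p k)) k * z ^ k)
      = - (1 / 4) * bessel_entire (p + 1) z"
    unfolding diffs_bessel_coeff bessel_entire_def using summable_bessel_entire[of "p + 1" z] assms
    by (subst suminf_mult[symmetric]) (auto simp: mult.assoc)
  finally show ?thesis .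
qed

lemma holomorphic_bessel_entire: "p > -1 \<Longrightarrow> bessel_entire p holomorphic_on A"
  using has_field_derivative_bessel_entire
  by (meson field_differentiable_at_within field_differentiable_def holomorphic_on_def)

lemma deriv_bessel_entire: "p > -1 \<Longrightarrow> deriv (bessel_entire p) z = - (1 / 4) * bessel_entire (p + 1) z"
  by (intro DERIV_imp_deriv has_field_derivative_bessel_entire)

text \<open>This is the three-term recurrence \<open>J\<^sub>p + J\<^sub>p\<^sub>+\<^sub>2 = 2 (p +
  1) / x * J\<^sub>p\<^sub>+\<^sub>1\<close> in terms of \<open>F\<close>. In
  \<open>bessel_coeff_shift\<close> the summand with factor \<open>k\<close> belongs to
  \<open>z\<close> times the derivative of \<open>F\<^sub>p\<^sub>+\<^sub>1\<close>, which is
  \<open>- z / 4\<close> times \<open>F\<^sub>p\<^sub>+\<^sub>2\<close>.\<close>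

lemma bessel_entire_recurrence:
  assumes "p > -1"
  shows "z / 4 * bessel_entire (p + 2) z = of_real (p + 1) * bessel_entire (p + 1) z - bessel_entire p z"
proof -
  let ?c = "\<lambda>k. complex_of_real (bessel_coeff (p + 1) k)"
  have p1: "p + 1 > -1" "p + 1 + 1 > -1" using assms by auto
  have "(\<lambda>k. of_real (bessel_coeff (p + 2) k) * z ^ k) sums bessel_entire (p + 2) z"
    using summable_bessel_entire[OF p1(2), of z] unfolding bessel_entire_def
    by (simp add: summable_sums add_ac)
  then have "(\<lambda>k. (- z / 4) * (of_real (bessel_coeff (p + 2) k) * z ^ k)) sums (- z / 4 * bessel_entire (p + 2) z)"
    by (rule sums_mult)
  moreover have "(- z / 4) * (of_real (bessel_coeff (p + 2) k) * z ^ k) = of_nat (Suc k) * ?c (Suc k) * z ^ Suc k" for k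
  proof -
    have "of_nat (Suc k) * ?c (Suc k) = of_real (of_nat (Suc k) * bessel_coeff (p + 1) (Suc k))" by simp
    also have "\<dots> = - of_real (bessel_coeff (p + 2) k) / 4"
      unfolding bessel_coeff_Suc by (simp add: add_ac)
    finally show ?thesis by simp
  qed
  ultimately have "(\<lambda>k. of_nat (Suc k) * ?c (Suc k) * z ^ Suc k) sums (- z / 4 * bessel_entire (p + 2) z)"
    by simp
  then have A: "(\<lambda>k. of_nat k * ?c k * z ^ k) sums (- z / 4 * bessel_entire (p + 2) z)"
    by (subst (asm) sums_Suc_iff) simp
  have B: "(\<lambda>k. of_real (p + 1) * (?c k * z ^ k)) sums (of_real (p + 1) * bessel_entire (p + 1) z)"
    using summable_bessel_entire[OF p1(1), of z] unfolding bessel_entire_def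
    by (intro sums_mult summable_sums)
  have "(\<lambda>k. of_nat k * ?c k * z ^ k + of_real (p + 1) * (?c k * z ^ k)) sums
      (- z / 4 * bessel_entire (p + 2) z + of_real (p + 1) * bessel_entire (p + 1) z)"
    by (rule sums_add[OF A B])
  moreover have "of_nat k * ?c k * z ^ k + of_real (p + 1) * (?c k * z ^ k) = of_real (bessel_coeff p k) * z ^ k" for k
    unfolding bessel_coeff_shift[OF assms] by (simp add: algebra_simps)
  ultimately have "(\<lambda>k. of_real (bessel_coeff p k) * z ^ k) sums
      (- z / 4 * bessel_entire (p + 2) z + of_real (p + 1) * bessel_entire (p + 1) z)"
    by simp
  then have "bessel_entire p z = - z / 4 * bessel_entire (p + 2) z + of_real (p + 1) * bessel_entire (p + 1) z"
    unfolding bessel_entire_def by (rule sums_unique[symmetric])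
  then show ?thesis by simp
qed

lemma bessel_entire_of_real:
  assumes "p > -1"
  shows "bessel_entire p (of_real x) = of_real (\<Sum>k. bessel_coeff p k * x ^ k)"
    and "summable (\<lambda>k. bessel_coeff p k * x ^ k)"
proof -
  have "summable (\<lambda>k. complex_of_real (bessel_coeff p k * x ^ k))"
    using summable_bessel_entire[OF assms, of "of_real x"] by simp
  then show s: "summable (\<lambda>k. bessel_coeff p k * x ^ k)"
    by (simp only: summable_of_real_iff)
  show "bessel_entire p (of_real x) = of_real (\<Sum>k. bessel_coeff p k * x ^ k)"
    unfolding bessel_entire_def suminf_of_real[OF s] by simp
qed

lemma bessel_J_eq_bessel_entire:
  assumes "p > -1"
  shows "complex_of_real (bessel_J p x) = of_real ((x / 2) powr p) * bessel_entire p (of_real (x\<^sup>2))"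
proof -
  have "(-1) ^ k / (fact k * Gamma (p + real k + 1)) * (x / 2) ^ (2 * k) = bessel_coeff p k * (x\<^sup>2) ^ k" for k
    by (simp add: bessel_coeff_def power_mult power_divide)
  then show ?thesis
    unfolding bessel_J_def bessel_entire_of_real(1)[OF assms] by simp
qed

section \<open>Zeros of \<open>F\<^sub>p\<close>: simplicity, infinitude and discreteness\<close>

text \<open>For \<open>x <= 0\<close> the alternating signs cancel against those of
  \<open>x ^ k\<close>, and the constant term is positive.\<close>

lemma bessel_entire_nonpos_neq_0:
  assumes "p > -1" "x \<le> 0"
  shows "bessel_entire p (of_real x) \<noteq> 0"
proof -
  have Gpos: "Gamma (p + real k + 1) > 0" for k using assms by (intro Gamma_real_pos) simp
  have eq: "bessel_coeff p k * x ^ k = (- x) ^ k / (4 ^ k * fact k * Gamma (p + real k + 1))" for k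
    by (simp add: bessel_coeff_def power_minus[of x])
  have "0 < (\<Sum>k. bessel_coeff p k * x ^ k)"
  proof (rule suminf_pos2[of _ 0])
    show "summable (\<lambda>k. bessel_coeff p k * x ^ k)" by (rule bessel_entire_of_real(2)[OF assms(1)])
    show "0 \<le> bessel_coeff p k * x ^ k" for k
      unfolding eq using assms(2) less_imp_le[OF Gpos[of k]] by simp
    show "0 < bessel_coeff p 0 * x ^ 0" unfolding eq using Gpos[of 0] by simp
  qed
  then show ?thesis unfolding bessel_entire_of_real(1)[OF assms(1)] by simp
qed

lemma bessel_entire_0_neq_0: "p > -1 \<Longrightarrow> bessel_entire p 0 \<noteq> 0"
  using bessel_entire_nonpos_neq_0[of p 0] by simp

lemma higher_deriv_bessel_entire:
  assumes "p > -1"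
  shows "(deriv ^^ n) (bessel_entire p) z = (- (1 / 4)) ^ n * bessel_entire (p + real n) z"
proof (induction n arbitrary: z)
  case (Suc n)
  have "(deriv ^^ n) (bessel_entire p) = (\<lambda>z. (- (1 / 4)) ^ n * bessel_entire (p + real n) z)"
    using Suc.IH by blast
  moreover have "((\<lambda>z. (- (1 / 4)) ^ n * bessel_entire (p + real n) z) has_field_derivative
      (- (1 / 4)) ^ n * (- (1 / 4) * bessel_entire (p + real n + 1) z)) (at z)"
    using assms by (intro DERIV_cmult has_field_derivative_bessel_entire) simp
  ultimately show ?case by (simp add: DERIV_imp_deriv add_ac)
qed simp

text \<open>A common zero is not \<open>0\<close>, so the recurrence carries it to all orders
  \<open>p + n\<close>. Then every derivative of \<open>F\<^sub>p\<close> vanishes there, against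
  the identity theorem.\<close>

lemma bessel_entire_no_common_zero:
  assumes "p > -1" "bessel_entire p a = 0"
  shows "bessel_entire (p + 1) a \<noteq> 0"
proof
  assume 1: "bessel_entire (p + 1) a = 0"
  have "a \<noteq> 0" using assms bessel_entire_0_neq_0 by auto
  have "bessel_entire (p + real n) a = 0 \<and> bessel_entire (p + real n + 1) a = 0" for n
  proof (induction n)
    case (Suc n)
    have "a / 4 * bessel_entire (p + real n + 2) a = 0"
      using bessel_entire_recurrence[of "p + real n" a] Suc assms by simp
    then show ?case using Suc \<open>a \<noteq> 0\<close> by (simp add: add_ac)
  qed (use assms 1 in simp)
  then have "(deriv ^^ n) (bessel_entire p) a = 0" for n
    unfolding higher_deriv_bessel_entire[OF assms(1)] by simp
  then have "bessel_entire p 0 = 0"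
    using holomorphic_fun_eq_0_on_connected[of "bessel_entire p" UNIV a 0]
      holomorphic_bessel_entire[OF assms(1)] by auto
  then show False using bessel_entire_0_neq_0[OF assms(1)] by simp
qed

lemma deriv_bessel_entire_neq_0:
  "p > -1 \<Longrightarrow> bessel_entire p a = 0 \<Longrightarrow> deriv (bessel_entire p) a \<noteq> 0"
  using bessel_entire_no_common_zero by (simp add: deriv_bessel_entire)

text \<open>With finitely many zeros \<open>F\<^sub>p\<close> would be a polynomial, yet its
  derivatives at \<open>0\<close> are nonzero multiples of \<open>F\<^sub>p\<^sub>+\<^sub>n\<close>
  at \<open>0\<close> and never vanish.\<close>

lemma infinite_zeros_bessel_entire:
  assumes "p > -1"
  shows "infinite {a. bessel_entire p a = 0}"
proof
  assume "finite {a. bessel_entire p a = 0}"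
  then obtain q where q: "\<And>z. bessel_entire p z = poly q z"
    using entire_finite_zeros_imp_poly[OF holomorphic_bessel_entire[OF assms] bessel_entire_0_neq_0[OF assms]
      bessel_entire_growth[OF assms] deriv_bessel_entire_neq_0[OF assms]] by blast
  have "(deriv ^^ n) (poly q) = poly ((pderiv ^^ n) q)" for n
  proof (induction n)
    case (Suc n)
    have "deriv (poly r) = poly (pderiv r)" for r :: "complex poly"
      by (rule ext) (intro DERIV_imp_deriv poly_DERIV)
    then show ?case using Suc by simp
  qed simp
  moreover have "(pderiv ^^ n) q = 0" if "degree q < n" for n
    using that
  proof (induction n arbitrary: q)
    case (Suc n)
    have "(pderiv ^^ n) (pderiv q) = 0"
    proof (cases "degree q")
      case 0
      then have "pderiv q = 0" by (simp add: pderiv_eq_0_iff)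
      moreover have "(pderiv ^^ n) (0::complex poly) = 0" by (induction n) auto
      ultimately show ?thesis by simp
    next
      case (Suc m)
      then show ?thesis using Suc.IH[of "pderiv q"] Suc.prems by (simp add: degree_pderiv)
    qed
    then show ?case by (simp add: funpow_swap1)
  qed simp
  ultimately have "(deriv ^^ Suc (degree q)) (poly q) 0 = 0" by (metis lessI poly_0)
  moreover have "bessel_entire p = poly q" using q by blast
  ultimately show False
    using higher_deriv_bessel_entire[OF assms, of "Suc (degree q)" 0]
      bessel_entire_0_neq_0[of "p + real (Suc (degree q))"] assms by simp
qed

lemma finite_zeros_bessel_entire:
  assumes "p > -1"
  shows "finite {a. bessel_entire p a = 0 \<and> norm a \<le> R}"
proof -
  \<comment> \<open>A constant would be the nonzero value at \<open>0\<close> and leave no zeros at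
    all.\<close>
  have "\<not> bessel_entire p constant_on UNIV"
  proof
    assume "bessel_entire p constant_on UNIV"
    then obtain c where "\<And>z. bessel_entire p z = c" by (auto simp: constant_on_def)
    then have "{a. bessel_entire p a = 0} = {}" using bessel_entire_0_neq_0[OF assms] by auto
    then show False using infinite_zeros_bessel_entire[OF assms] by (metis finite.emptyI)
  qed
  then have "finite {z \<in> cball 0 R. bessel_entire p z = 0}"
    using holomorphic_bessel_entire[OF assms] by (intro holomorphic_compact_finite_zeros[of _ UNIV]) auto
  then show ?thesis by (rule rev_finite_subset) auto
qed

section \<open>Positive zeros of Bessel functions\<close>

text \<open>With \<open>A t = F\<^sub>p(z t)\<close> and \<open>B t = t\<^bsup>p+1\<^esup> F\<^sub>p\<^sub>+\<^sub>1(z t)\<close>, Bessel's equation is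
  \<open>B' = t\<^bsup>p\<^esup> A\<close>, \<open>A' = - (z / 4) t\<^bsup>-p-1\<^esup> B\<close>, so \<open>Im (z B cnj A) / Im z\<close> has derivative
  \<open>t\<^bsup>p\<^esup> \<bar>A\<bar>\<^sup>2\<close>; it vanishes at \<open>0\<close>, and at \<open>1\<close> when \<open>z\<close> is a zero.\<close>

lemma bessel_entire_zero_real:
  assumes p: "p > -1" and z: "bessel_entire p z = 0"
  shows "Im z = 0"
proof (rule ccontr)
  assume Im: "Im z \<noteq> 0"
  define A where "A = (\<lambda>t::real. bessel_entire p (z * of_real t))"
  define A1 where "A1 = (\<lambda>t::real. bessel_entire (p + 1) (z * of_real t))"
  define A2 where "A2 = (\<lambda>t::real. bessel_entire (p + 2) (z * of_real t))"
  define W where "W = (\<lambda>t. (t powr (p + 1)) * (Im (z * A1 t * cnj (A t)) / Im z))"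
  have dz: "((\<lambda>t. z * of_real t) has_vector_derivative z) (at t)" for t
    by (auto intro!: derivative_eq_intros)
  have dA: "(A has_vector_derivative (z * (- (1 / 4) * A1 t))) (at t)" for t
    using field_vector_diff_chain_at[OF dz has_field_derivative_bessel_entire[OF p]]
    unfolding A_def A1_def o_def .
  have dA1: "(A1 has_vector_derivative (z * (- (1 / 4) * A2 t))) (at t)" for t
    using field_vector_diff_chain_at[OF dz has_field_derivative_bessel_entire[of "p + 1"]] p
    unfolding A2_def A1_def o_def by (simp add: add_ac)
  have cont: "continuous_on S A" "continuous_on S A1" for S
    by (intro continuous_at_imp_continuous_on ballI has_vector_derivative_continuous[OF dA]
      has_vector_derivative_continuous[OF dA1])+
  have contW: "continuous_on {0..b} W" for b
    unfolding W_def using p Im by (intro continuous_intros cont continuous_on_powr') auto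
  have dW: "(W has_real_derivative (t powr p * (norm (A t))\<^sup>2)) (at t)" if "t > 0" for t
  proof -
    define N where "N = z * (- (1 / 4) * A2 t) * cnj (A t) + A1 t * cnj (z * (- (1 / 4) * A1 t))"
    have "((\<lambda>t. A1 t * cnj (A t)) has_vector_derivative
        A1 t * cnj (z * (- (1 / 4) * A1 t)) + z * (- (1 / 4) * A2 t) * cnj (A t)) (at t)"
      by (intro has_vector_derivative_mult dA1 has_vector_derivative_cnj dA)
    then have "((\<lambda>t. z * (A1 t * cnj (A t))) has_vector_derivative z * N) (at t)"
      unfolding N_def by (intro has_vector_derivative_mult_right) (simp add: add.commute)
    then have dIm: "((\<lambda>t. Im (z * (A1 t * cnj (A t)))) has_real_derivative Im (z * N)) (at t)"
      by (rule has_field_derivative_Im)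
    have dP: "((\<lambda>t. t powr (p + 1)) has_real_derivative (p + 1) * t powr p) (at t)"
      using has_real_derivative_powr[OF that, of "p + 1"] by simp
    have "(W has_real_derivative ((p + 1) * t powr p * (Im (z * (A1 t * cnj (A t))) / Im z)
        + Im (z * N) / Im z * t powr (p + 1))) (at t)"
      unfolding W_def mult.assoc[of z] by (rule DERIV_mult[OF dP DERIV_cdivide[OF dIm]])
    also have "(p + 1) * t powr p * (Im (z * (A1 t * cnj (A t))) / Im z)
        + Im (z * N) / Im z * t powr (p + 1)
      = t powr p * (Im (z * (of_real (p + 1) * A1 t * cnj (A t) + of_real t * N)) / Im z)"
    proof -
      have "t powr (p + 1) = t powr p * t" using that by (simp add: powr_add)
      moreover have "z * (of_real (p + 1) * A1 t * cnj (A t) + of_real t * N)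
        = of_real (p + 1) * (z * (A1 t * cnj (A t))) + of_real t * (z * N)"
        by (simp add: algebra_simps)
      moreover have "Im (of_real (p + 1) * X + of_real t * Y) = (p + 1) * Im X + t * Im Y" for X Y
        by simp
      ultimately show ?thesis by (simp only:) (simp add: field_simps Im)
    qed
    \<comment> \<open>The recurrence at \<open>z * of_real t\<close> removes \<open>A2\<close>; what
      remains besides \<open>z * (norm (A t))\<^sup>2\<close> is real and drops out of the imaginary
      part.\<close>
    also have "z * (of_real (p + 1) * A1 t * cnj (A t) + of_real t * N)
      = z * of_real ((norm (A t))\<^sup>2) - of_real (t / 4 * (norm z)\<^sup>2 * (norm (A1 t))\<^sup>2)"
    proof -
      have "z * of_real t / 4 * A2 t = of_real (p + 1) * A1 t - A t"
        using bessel_entire_recurrence[OF p, of "z * of_real t"] by (simp add: A_def A1_def A2_def)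
      then have E: "of_real (p + 1) * A1 t - z * of_real t / 4 * A2 t = A t"
        by (simp only: diff_diff_eq2 diff_add_eq add_diff_cancel_left')
      have M: "of_real (p + 1) * A1 t * cnj (A t) + of_real t * N
        = (of_real (p + 1) * A1 t - z * of_real t / 4 * A2 t) * cnj (A t)
          - of_real t / 4 * cnj z * (A1 t * cnj (A1 t))"
        unfolding N_def by (simp add: algebra_simps)
      have "z * (of_real (p + 1) * A1 t * cnj (A t) + of_real t * N)
        = z * (A t * cnj (A t)) - of_real t / 4 * (z * cnj z) * (A1 t * cnj (A1 t))"
        unfolding M E by (simp add: algebra_simps)
      then show ?thesis by (simp add: complex_norm_square[symmetric])
    qed
    also have "Im (z * of_real ((norm (A t))\<^sup>2) - of_real (t / 4 * (norm z)\<^sup>2 * (norm (A1 t))\<^sup>2))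
        = Im z * (norm (A t))\<^sup>2"
      by (simp only: minus_complex.sel Im_complex_of_real) simp
    finally show ?thesis using Im by simp
  qed
  have "A 0 \<noteq> 0" using bessel_entire_0_neq_0[OF p] by (simp add: A_def)
  moreover have "isCont A 0" using has_vector_derivative_continuous[OF dA[of 0]] by simp
  ultimately obtain d where d: "d > 0" "\<And>t. dist 0 t < d \<Longrightarrow> A t \<noteq> 0"
    using continuous_at_avoid[of 0 A 0] by auto
  \<comment> \<open>On \<open>[0, e]\<close> the function \<open>A\<close> has no zero, so
    \<open>W\<close> strictly gains there; on \<open>[e, 1]\<close> it does not decrease. Together
    this contradicts \<open>W 0 = W 1 = 0\<close>.\<close>
  define e where "e = min (d / 2) (1 / 2)"
  have e: "0 < e" "e < 1" "e < d" using d(1) by (auto simp: e_def)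
  have ex: "\<exists>t>a. t < b \<and> W b - W a = (b - a) * (t powr p * (norm (A t))\<^sup>2)" if "0 \<le> a" "a < b" for a b
  proof -
    have "continuous_on {a..b} W"
      using contW[of b] by (rule continuous_on_subset) (use that in auto)
    moreover have "W differentiable (at t)" if "a < t" "t < b" for t
      using dW[of t] that \<open>0 \<le> a\<close> real_differentiable_def by force
    ultimately obtain l t where t: "a < t" "t < b" "DERIV W t :> l" "W b - W a = (b - a) * l"
      using MVT[OF \<open>a < b\<close>] by blast
    moreover have "l = t powr p * (norm (A t))\<^sup>2"
      using DERIV_unique[OF t(3) dW[of t]] t(1) \<open>0 \<le> a\<close> by simp
    ultimately show ?thesis by blast
  qed
  obtain t where t: "0 < t" "t < e" "W e - W 0 = (e - 0) * (t powr p * (norm (A t))\<^sup>2)"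
    using ex[of 0 e] e by auto
  have "A t \<noteq> 0" using t(1,2) e d(2)[of t] by (simp add: dist_norm)
  then have "W e - W 0 > 0" unfolding t(3) using t(1) e by simp
  moreover obtain u where "W 1 - W e = (1 - e) * (u powr p * (norm (A u))\<^sup>2)"
    using ex[of e 1] e by auto
  then have "W 1 - W e \<ge> 0" using e by simp
  moreover have "W 0 = 0" using p by (simp add: W_def)
  moreover have "W 1 = 0" using z by (simp add: W_def A_def)
  ultimately show False by simp
qed

lemma bessel_entire_zero_pos:
  assumes p: "p > -1" and z: "bessel_entire p z = 0"
  obtains x where "x > 0" "z = of_real x"
proof
  have z': "z = of_real (Re z)" using bessel_entire_zero_real[OF assms] by (simp add: complex_eq_iff)
  then show "z = of_real (Re z)" .
  show "Re z > 0"
  proof (rule ccontr)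
    assume "\<not> Re z > 0"
    then show False using bessel_entire_nonpos_neq_0[OF p, of "Re z"] z z' by simp
  qed
qed

definition bessel_zeros :: "real \<Rightarrow> real set" where
  "bessel_zeros p = {x. 0 < x \<and> bessel_J p x = 0}"

lemma bessel_zeros_iff:
  assumes "p > -1"
  shows "x \<in> bessel_zeros p \<longleftrightarrow> x > 0 \<and> bessel_entire p (of_real (x\<^sup>2)) = 0"
proof -
  have "bessel_J p x = 0 \<longleftrightarrow> bessel_entire p (of_real (x\<^sup>2)) = 0" if "x > 0"
  proof -
    have "bessel_J p x = 0 \<longleftrightarrow> complex_of_real (bessel_J p x) = 0" by simp
    also have "\<dots> \<longleftrightarrow> bessel_entire p (of_real (x\<^sup>2)) = 0"
      unfolding bessel_J_eq_bessel_entire[OF assms] using that by simp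
    finally show ?thesis .
  qed
  then show ?thesis by (auto simp: bessel_zeros_def)
qed

text \<open>Turns sums over the zeros of \<open>F\<^sub>p\<close> in a disc into sums over positive
  zeros of the Bessel function. It rests on all zeros of \<open>F\<^sub>p\<close> being positive
  reals.\<close>

lemma bij_betw_bessel_zeros:
  assumes "p > -1"
  shows "bij_betw (\<lambda>x. complex_of_real (x\<^sup>2)) {x \<in> bessel_zeros p. x\<^sup>2 \<le> R}
    {a. bessel_entire p a = 0 \<and> norm a \<le> R}"
proof (rule bij_betwI[where g = "\<lambda>a. sqrt (Re a)"])
  show "(\<lambda>x. complex_of_real (x\<^sup>2)) \<in> {x \<in> bessel_zeros p. x\<^sup>2 \<le> R} \<rightarrow>
      {a. bessel_entire p a = 0 \<and> norm a \<le> R}"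
    using bessel_zeros_iff[OF assms] by (auto simp: norm_power simp flip: of_real_power)
  have *: "\<exists>x>0. a = of_real (x\<^sup>2)" if zero: "bessel_entire p a = 0" for a
  proof -
    obtain u where "u > 0" "a = of_real u" by (rule bessel_entire_zero_pos[OF assms zero])
    then show ?thesis by (intro exI[of _ "sqrt u"]) simp
  qed
  show "(\<lambda>a. sqrt (Re a)) \<in> {a. bessel_entire p a = 0 \<and> norm a \<le> R} \<rightarrow>
      {x \<in> bessel_zeros p. x\<^sup>2 \<le> R}"
    using * bessel_zeros_iff[OF assms] by (fastforce simp: norm_power simp flip: of_real_power)
  show "sqrt (Re (complex_of_real (x\<^sup>2))) = x" if "x \<in> {x \<in> bessel_zeros p. x\<^sup>2 \<le> R}" for x
    using that by (simp add: bessel_zeros_def)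
  show "complex_of_real ((sqrt (Re a))\<^sup>2) = a" if "a \<in> {a. bessel_entire p a = 0 \<and> norm a \<le> R}" for a
    using *[of a] that by auto
qed

lemma finite_bessel_zeros_le:
  assumes "p > -1"
  shows "finite {x \<in> bessel_zeros p. x\<^sup>2 \<le> R}"
  using bij_betw_finite[OF bij_betw_bessel_zeros[OF assms]] finite_zeros_bessel_entire[OF assms] by blast

lemma infinite_bessel_zeros:
  assumes "p > -1"
  shows "infinite (bessel_zeros p)"
proof
  assume "finite (bessel_zeros p)"
  then have "finite ((\<lambda>x. complex_of_real (x\<^sup>2)) ` bessel_zeros p)" by simp
  moreover have "{a. bessel_entire p a = 0} \<subseteq> (\<lambda>x. complex_of_real (x\<^sup>2)) ` bessel_zeros p"
  proof
    fix a assume "a \<in> {a. bessel_entire p a = 0}"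
    then have "a \<in> {a'. bessel_entire p a' = 0 \<and> norm a' \<le> norm a}" by simp
    then show "a \<in> (\<lambda>x. complex_of_real (x\<^sup>2)) ` bessel_zeros p"
      using bij_betw_imp_surj_on[OF bij_betw_bessel_zeros[OF assms, of "norm a"]] by blast
  qed
  ultimately show False using infinite_zeros_bessel_entire[OF assms] finite_subset by blast
qed

section \<open>Enumeration of the positive zeros\<close>

text \<open>The rank is strictly increasing on \<open>S\<close>, hence injective. The least element
  whose rank is at least \<open>m\<close> has rank exactly \<open>m\<close>.\<close>

lemma bij_betw_card_le:
  fixes S :: "real set"
  assumes inf: "infinite S" and fin: "\<And>x. finite {t \<in> S. t \<le> x}"
  shows "bij_betw (\<lambda>x. card {t \<in> S. t \<le> x}) S {1..}"
  unfolding bij_betw_def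
proof (intro conjI equalityI subsetI)
  let ?r = "\<lambda>x. card {t \<in> S. t \<le> x}"
  have less: "?r x < ?r y" if "y \<in> S" "x < y" for x y
  proof (intro psubset_card_mono fin psubsetI)
    have "y \<in> {t \<in> S. t \<le> y}" "y \<notin> {t \<in> S. t \<le> x}" using that by auto
    then show "{t \<in> S. t \<le> x} \<noteq> {t \<in> S. t \<le> y}" by blast
  qed (use that in auto)
  show "inj_on ?r S"
    by (rule linorder_inj_onI') (use less in force)
  show "m \<in> {1..}" if "m \<in> ?r ` S" for m
    using that fin by (auto simp: Suc_le_eq card_gt_0_iff)
  show "m \<in> ?r ` S" if "m \<in> {1..}" for m
  proof -
    have m: "m \<ge> 1" using that by simp
    obtain T where T: "T \<subseteq> S" "finite T" "card T = m"
      using infinite_arbitrarily_large[OF inf] by blast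
    then have "T \<noteq> {}" using m by auto
    define x0 where "x0 = Max T"
    have "x0 \<in> S" using Max_in[OF T(2) \<open>T \<noteq> {}\<close>] T(1) by (auto simp: x0_def)
    have "m \<le> ?r x0" unfolding T(3)[symmetric]
      using T fin by (intro card_mono) (auto simp: x0_def)
    \<comment> \<open>The cut at \<open>x0\<close> makes this set finite, so that a least element
      exists.\<close>
    define U where "U = {x \<in> S. x \<le> x0 \<and> m \<le> ?r x}"
    have finU: "finite U" using fin[of x0] by (rule rev_finite_subset) (auto simp: U_def)
    have "x0 \<in> U" using \<open>x0 \<in> S\<close> \<open>m \<le> ?r x0\<close> by (simp add: U_def)
    define x where "x = Min U"
    have "x \<in> U" unfolding x_def using finU \<open>x0 \<in> U\<close> by (intro Min_in) auto
    then have x: "x \<in> S" "x \<le> x0" "m \<le> ?r x" by (auto simp: U_def)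
    have "?r x = m"
    proof (rule ccontr)
      assume "?r x \<noteq> m"
      then have gt: "m < ?r x" using x(3) by simp
      \<comment> \<open>The largest element of \<open>V\<close> is the predecessor of
        \<open>x\<close> in \<open>S\<close>. Its rank is still at least \<open>m\<close>,
        contradicting the minimality of \<open>x\<close>.\<close>
      define V where "V = {t \<in> S. t \<le> x} - {x}"
      have V: "finite V" "card V = ?r x - 1" using fin x(1) by (auto simp: V_def)
      then have "V \<noteq> {}" using gt m by auto
      define y where "y = Max V"
      have "y \<in> V" unfolding y_def using V(1) \<open>V \<noteq> {}\<close> by (rule Max_in)
      then have y: "y \<in> S" "y < x" by (auto simp: V_def)
      have "V \<subseteq> {t \<in> S. t \<le> y}" using V(1) by (auto simp: y_def V_def)
      then have "card V \<le> ?r y" using fin by (intro card_mono)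
      then have "y \<in> U" using y x gt V(2) by (auto simp: U_def)
      then show False using Min_le[OF finU, of y] y(2) by (simp add: x_def)
    qed
    then show ?thesis using x(1) by blast
  qed
qed

text \<open>On \<open>{1..}\<close> the definite description in \<open>bessel_zero\<close> is the
  inverse of the rank function and is therefore well defined.\<close>

lemma bij_betw_bessel_zero:
  assumes "p > -1"
  shows "bij_betw (bessel_zero p) {1..} (bessel_zeros p)"
proof -
  let ?r = "\<lambda>x. card {t \<in> bessel_zeros p. t \<le> x}"
  have "finite {t \<in> bessel_zeros p. t \<le> x}" for x
    using finite_bessel_zeros_le[OF assms, of "x\<^sup>2"]
    by (rule rev_finite_subset) (auto simp: bessel_zeros_def intro: power_mono)
  then have bij: "bij_betw ?r (bessel_zeros p) {1..}"
    by (intro bij_betw_card_le infinite_bessel_zeros[OF assms])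
  have "bessel_zero p m = inv_into (bessel_zeros p) ?r m" if "m \<in> {1..}" for m
    unfolding bessel_zero_def
  proof (rule the_equality)
    have eq: "{t. 0 < t \<and> t \<le> x \<and> bessel_J p t = 0} = {t \<in> bessel_zeros p. t \<le> x}" for x
      by (auto simp: bessel_zeros_def)
    have m: "m \<in> ?r ` bessel_zeros p" using bij that by (simp add: bij_betw_def)
    show "0 < inv_into (bessel_zeros p) ?r m \<and> bessel_J p (inv_into (bessel_zeros p) ?r m) = 0 \<and>
        card {t. 0 < t \<and> t \<le> inv_into (bessel_zeros p) ?r m \<and> bessel_J p t = 0} = m"
      unfolding eq using inv_into_into[OF m] f_inv_into_f[OF m] by (simp add: bessel_zeros_def)
    fix x assume x: "0 < x \<and> bessel_J p x = 0 \<and> card {t. 0 < t \<and> t \<le> x \<and> bessel_J p t = 0} = m"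
    then have "x \<in> bessel_zeros p" "?r x = m" unfolding eq by (auto simp: bessel_zeros_def)
    then show "x = inv_into (bessel_zeros p) ?r m"
      using inv_into_f_f[OF bij_betw_imp_inj_on[OF bij], of x] by simp
  qed
  then show ?thesis
    using bij_betw_inv_into[OF bij] bij_betw_cong[of "{1..}" "bessel_zero p"] by blast
qed

section \<open>Taylor coefficients and sums over zeros\<close>

lemma filterlim_sublevel_finite_subsets:
  fixes s :: "'a \<Rightarrow> real"
  assumes "\<And>R. finite {x \<in> Z. s x \<le> R}"
  shows "filterlim (\<lambda>R. {x \<in> Z. s x \<le> R}) (finite_subsets_at_top Z) at_top"
  unfolding filterlim_finite_subsets_at_top
proof (intro allI impI, elim conjE)
  fix X assume X: "finite X" "X \<subseteq> Z"
  obtain B where B: "\<And>x. x \<in> X \<Longrightarrow> s x \<le> B"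
    using bdd_above_finite[OF finite_imageI[OF X(1)], of s] by (auto simp: bdd_above_def)
  show "\<forall>\<^sub>F R in at_top. finite {x \<in> Z. s x \<le> R} \<and> X \<subseteq> {x \<in> Z. s x \<le> R} \<and> {x \<in> Z. s x \<le> R} \<subseteq> Z"
    using eventually_ge_at_top[of B]
  proof eventually_elim
    case (elim R)
    then show ?case using assms X(2) B by (auto intro: order_trans)
  qed
qed

text \<open>Once summability is known, the unordered sum is the limit along every exhaustion by
  finite sets; \<open>s\<close> will be the square, matching growing discs.\<close>

lemma infsum_eq_sublevel_limit:
  fixes s :: "'a \<Rightarrow> real" and g :: "'a \<Rightarrow> real"
  assumes "\<And>R. finite {x \<in> Z. s x \<le> R}"
    and "((\<lambda>R. \<Sum>x | x \<in> Z \<and> s x \<le> R. g x) \<longlongrightarrow> L) at_top"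
    and "g summable_on Z"
  shows "infsum g Z = L"
proof -
  have "(sum g \<longlongrightarrow> infsum g Z) (finite_subsets_at_top Z)"
    using has_sum_infsum[OF assms(3)] by (simp add: has_sum_def)
  from filterlim_compose[OF this filterlim_sublevel_finite_subsets[OF assms(1)]]
  have "((\<lambda>R. \<Sum>x | x \<in> Z \<and> s x \<le> R. g x) \<longlongrightarrow> infsum g Z) at_top" .
  then show ?thesis using assms(2) by (rule tendsto_unique[OF trivial_limit_at_top_linorder])
qed

text \<open>With nonnegative terms the sums over sublevel sets eventually dominate any finite
  partial sum, so their limit bounds all of these.\<close>

lemma summable_on_sublevel_limit:
  fixes s :: "'a \<Rightarrow> real" and g :: "'a \<Rightarrow> real"
  assumes fin: "\<And>R. finite {x \<in> Z. s x \<le> R}"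
    and lim: "((\<lambda>R. \<Sum>x | x \<in> Z \<and> s x \<le> R. g x) \<longlongrightarrow> L) at_top"
    and nonneg: "\<And>x. x \<in> Z \<Longrightarrow> g x \<ge> 0"
  shows "g summable_on Z"
proof (rule nonneg_bdd_above_summable_on)
  show "bdd_above (sum g ` {X. X \<subseteq> Z \<and> finite X})"
  proof (rule bdd_aboveI2)
    fix X assume X: "X \<in> {X. X \<subseteq> Z \<and> finite X}"
    then obtain B where B: "\<And>x. x \<in> X \<Longrightarrow> s x \<le> B"
      using bdd_above_finite[OF finite_imageI, of X s] by (auto simp: bdd_above_def)
    have "\<forall>\<^sub>F R in at_top. sum g X \<le> (\<Sum>x | x \<in> Z \<and> s x \<le> R. g x)"
      using eventually_ge_at_top[of B]
    proof eventually_elim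
      case (elim R)
      show ?case
      proof (rule sum_mono2)
        show "X \<subseteq> {x \<in> Z. s x \<le> R}" using X order_trans[OF B elim] by blast
      qed (use fin nonneg in auto)
    qed
    then show "sum g X \<le> L"
      using lim by (intro tendsto_lowerbound) auto
  qed
qed (use nonneg in auto)

section \<open>The Riccati equation\<close>

text \<open>The function \<open>D\<^sub>p\<close> on the complex plane, written without square
  roots.\<close>

definition bessel_ratio :: "real \<Rightarrow> complex \<Rightarrow> complex" where
  "bessel_ratio p z = bessel_entire (p + 1) z / (4 * bessel_entire p z)"

lemma open_bessel_entire_neq_0: "p > -1 \<Longrightarrow> open {z. bessel_entire p z \<noteq> 0}"
  using holomorphic_on_imp_continuous_on[OF holomorphic_bessel_entire[of p UNIV]]
  by (intro open_Collect_neq) auto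

lemma holomorphic_bessel_ratio:
  "p > -1 \<Longrightarrow> bessel_ratio p holomorphic_on {z. bessel_entire p z \<noteq> 0}"
  unfolding bessel_ratio_def[abs_def]
  by (intro holomorphic_on_divide holomorphic_on_mult holomorphic_on_const holomorphic_bessel_entire) auto

lemma bessel_ratio_eq_log_deriv:
  "p > -1 \<Longrightarrow> - deriv (bessel_entire p) z / bessel_entire p z = bessel_ratio p z"
  by (simp add: deriv_bessel_entire bessel_ratio_def)

text \<open>The quotient rule brings in \<open>F\<^sub>p\<^sub>+\<^sub>2\<close>, which the
  three-term recurrence eliminates.\<close>

lemma bessel_ratio_Riccati:
  assumes p: "p > -1" and nz: "bessel_entire p z \<noteq> 0"
  shows "z * deriv (bessel_ratio p) z
    = z * (bessel_ratio p z * bessel_ratio p z) - of_real (p + 1) * bessel_ratio p z + 1 / 4"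
proof -
  define f where "f = bessel_entire p z"
  define f1 where "f1 = bessel_entire (p + 1) z"
  define f2 where "f2 = bessel_entire (p + 2) z"
  have f: "f \<noteq> 0" using nz by (simp add: f_def)
  have "(bessel_entire (p + 1) has_field_derivative - (1 / 4) * f2) (at z)"
    using has_field_derivative_bessel_entire[of "p + 1" z] p by (simp add: f2_def add_ac)
  moreover have "((\<lambda>z. 4 * bessel_entire p z) has_field_derivative 4 * (- (1 / 4) * f1)) (at z)"
    unfolding f1_def by (intro DERIV_cmult has_field_derivative_bessel_entire p)
  moreover have "4 * bessel_entire p z \<noteq> 0" using nz by simp
  ultimately have "(bessel_ratio p has_field_derivative
      (- (1 / 4) * f2 * (4 * f) - f1 * (4 * (- (1 / 4) * f1))) / ((4 * f) * (4 * f))) (at z)"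
    unfolding bessel_ratio_def[abs_def] f_def f1_def by (rule DERIV_divide)
  then have D: "deriv (bessel_ratio p) z
      = (- (1 / 4) * f2 * (4 * f) - f1 * (4 * (- (1 / 4) * f1))) / ((4 * f) * (4 * f))"
    by (rule DERIV_imp_deriv)
  have rec: "z / 4 * f2 = of_real (p + 1) * f1 - f"
    unfolding f_def f1_def f2_def by (rule bessel_entire_recurrence[OF p])
  have "z * deriv (bessel_ratio p) z = (- (z / 4 * f2) * (4 * f) + z * f1 * f1) / (16 * f * f)"
    unfolding D by (simp add: field_simps)
  also have "\<dots> = z * (f1 / (4 * f) * (f1 / (4 * f))) - of_real (p + 1) * (f1 / (4 * f)) + 1 / 4"
    unfolding rec using f by (simp add: field_simps)
  finally show ?thesis by (simp add: bessel_ratio_def f_def f1_def)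
qed

lemma D_fun_of_real:
  assumes p: "p > -1" and x: "x > 0"
  shows "bessel_ratio p (of_real x) = of_real (D_fun p x)"
proof -
  have s: "(sqrt x)\<^sup>2 = x" "sqrt x / 2 > 0" using x by auto
  have "complex_of_real (D_fun p x) = of_real (bessel_J (p + 1) (sqrt x)) /
      (2 * of_real (sqrt x) * of_real (bessel_J p (sqrt x)))"
    by (simp add: D_fun_def)
  also have "\<dots> = of_real ((sqrt x / 2) powr (p + 1)) * bessel_entire (p + 1) (of_real x) /
      (2 * of_real (sqrt x) * (of_real ((sqrt x / 2) powr p) * bessel_entire p (of_real x)))"
    using p s(1) by (simp add: bessel_J_eq_bessel_entire)
  also have "(sqrt x / 2) powr (p + 1) = (sqrt x / 2) powr p * (sqrt x / 2)"
    using s(2) by (simp add: powr_add)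
  also have "complex_of_real ((sqrt x / 2) powr p * (sqrt x / 2)) * bessel_entire (p + 1) (of_real x) /
      (2 * of_real (sqrt x) * (of_real ((sqrt x / 2) powr p) * bessel_entire p (of_real x)))
      = bessel_ratio p (of_real x)"
  proof -
    \<comment> \<open>For \<open>c = 0\<close>, at a zero of \<open>F\<^sub>p\<close>, both sides
      are \<open>0\<close> by the convention for division by zero.\<close>
    have "u * (v / 2) * b / (2 * v * (u * c)) = b / (4 * c)" if "u \<noteq> 0" "v \<noteq> 0" for u v b c :: complex
      using that by (cases "c = 0") (auto simp: field_simps)
    from this[of "of_real ((sqrt x / 2) powr p)" "of_real (sqrt x)"] show ?thesis
      using x by (simp add: bessel_ratio_def)
  qed
  finally show ?thesis by simp
qed

section \<open>Expansion of \<open>D\<^sub>p\<close> at a zero of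
  \<open>F\<^sub>p\<^sub>+\<^sub>1\<close>\<close>

context
  fixes p :: real and n :: nat and y :: real
  assumes p: "p > -1" and n: "n \<ge> 1" and y_def: "y = (bessel_zero (p + 1) n)\<^sup>2"
begin

lemma bessel_zero_sq_pos: "y > 0" and bessel_entire_succ_bessel_zero: "bessel_entire (p + 1) (of_real y) = 0"
proof -
  have p1: "p + 1 > -1" using p by simp
  have "bessel_zero (p + 1) n \<in> bessel_zeros (p + 1)"
    using bij_betw_apply[OF bij_betw_bessel_zero[OF p1], of n] n by simp
  then show "y > 0" "bessel_entire (p + 1) (of_real y) = 0"
    unfolding bessel_zeros_iff[OF p1] y_def by auto
qed

lemma bessel_entire_bessel_zero_succ_neq_0: "bessel_entire p (of_real y) \<noteq> 0"
  using bessel_entire_no_common_zero[OF p] bessel_entire_succ_bessel_zero by blast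

lemma higher_deriv_bessel_ratio:
  "(deriv ^^ k) (bessel_ratio p) (of_real y) = of_real ((deriv ^^ k) (D_fun p) y)"
proof (rule higher_deriv_of_real[OF holomorphic_bessel_ratio[OF p] open_bessel_entire_neq_0[OF p],
    where T = "{x. x > 0 \<and> bessel_entire p (of_real x) \<noteq> 0}"])
  have "open {x::real. bessel_entire p (of_real x) \<noteq> 0}"
    using open_vimage[OF open_bessel_entire_neq_0[OF p], of complex_of_real]
    by (simp add: vimage_def continuous_on_of_real_id)
  then show "open {x. x > 0 \<and> bessel_entire p (complex_of_real x) \<noteq> 0}"
    by (intro open_Collect_conj open_Collect_less continuous_intros)
qed (use D_fun_of_real[OF p] bessel_zero_sq_pos bessel_entire_bessel_zero_succ_neq_0 in auto)

text \<open>Coefficient \<open>k\<close> of the Riccati equation expanded at \<open>y\<close>. The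
  factor \<open>z\<close> becomes \<open>y\<close> plus the series variable, so each product with it
  contributes at \<open>k\<close> and at \<open>k - 1\<close>; the constant \<open>1 / 4\<close>
  enters only for \<open>k = 0\<close>.\<close>

lemma beta_plus_recurrence:
  "y * ((real k + 1) * beta_plus p n (k + 1)) + real k * beta_plus p n k
    = y * (\<Sum>i = 0..k. beta_plus p n i * beta_plus p n (k - i))
      + (if k = 0 then 1 / 4 else (\<Sum>i = 0..k - 1. beta_plus p n i * beta_plus p n (k - 1 - i)))
      - (p + 1) * beta_plus p n k"
proof -
  let ?w = "complex_of_real y" and ?G = "bessel_ratio p"
  let ?S = "{z. bessel_entire p z \<noteq> 0}"
  define B where "B = fps_expansion ?G ?w"
  have Bn: "fps_nth B i = of_real (beta_plus p n i)" for i
    unfolding B_def fps_expansion_def beta_plus_def y_def[symmetric]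
    by (simp add: higher_deriv_bessel_ratio)
  have "?G analytic_on {?w}"
    using holomorphic_bessel_ratio[OF p] open_bessel_entire_neq_0[OF p] bessel_entire_bessel_zero_succ_neq_0
    by (auto simp: analytic_at)
  then have B: "(\<lambda>x. ?G (?w + x)) has_fps_expansion B"
    unfolding B_def by (rule analytic_at_imp_has_fps_expansion)
  have W: "(\<lambda>x. ?w + x) has_fps_expansion (fps_const ?w + fps_X)"
    by (intro fps_expansion_intros)
  have "\<forall>\<^sub>F x in nhds 0. x \<in> (\<lambda>x. ?w + x) -` ?S"
    using bessel_entire_bessel_zero_succ_neq_0 open_bessel_entire_neq_0[OF p]
    by (intro eventually_nhds_in_open open_vimage continuous_intros) auto
  then have ev: "\<forall>\<^sub>F x in nhds 0. (?w + x) * deriv (\<lambda>x. ?G (?w + x)) x =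
      (?w + x) * (?G (?w + x) * ?G (?w + x)) - of_real (p + 1) * ?G (?w + x) + 1 / 4"
  proof eventually_elim
    case (elim x)
    then have nz: "bessel_entire p (?w + x) \<noteq> 0" by simp
    have "(?G has_field_derivative deriv ?G (?w + x)) (at (?w + x))"
      using nz by (intro holomorphic_derivI[OF holomorphic_bessel_ratio[OF p] open_bessel_entire_neq_0[OF p]]) simp
    then have "((\<lambda>x. ?G (?w + x)) has_field_derivative deriv ?G (?w + x)) (at x)"
      by (simp add: DERIV_shift add.commute)
    then have "deriv (\<lambda>x. ?G (?w + x)) x = deriv ?G (?w + x)" by (rule DERIV_imp_deriv)
    then show ?case using bessel_ratio_Riccati[OF p nz] by simp
  qed
  have "(\<lambda>x. (?w + x) * deriv (\<lambda>x. ?G (?w + x)) x) has_fps_expansion (fps_const ?w + fps_X) * fps_deriv B"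
    by (intro has_fps_expansion_mult W has_fps_expansion_deriv B)
  moreover have "(\<lambda>x. (?w + x) * (?G (?w + x) * ?G (?w + x)) - of_real (p + 1) * ?G (?w + x) + 1 / 4)
      has_fps_expansion (fps_const ?w + fps_X) * (B * B) - fps_const (of_real (p + 1)) * B + fps_const (1 / 4)"
    by (intro has_fps_expansion_add has_fps_expansion_diff has_fps_expansion_mult has_fps_expansion_const W B)
  ultimately have "(fps_const ?w + fps_X) * fps_deriv B =
      (fps_const ?w + fps_X) * (B * B) - fps_const (of_real (p + 1)) * B + fps_const (1 / 4)"
    using has_fps_expansion_cong[OF ev refl] fps_expansion_unique_complex by blast
  then have eq: "fps_nth ((fps_const ?w + fps_X) * fps_deriv B) k =
      fps_nth ((fps_const ?w + fps_X) * (B * B) - fps_const (of_real (p + 1)) * B + fps_const (1 / 4)) k"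
    by simp
  have shift: "fps_nth ((fps_const ?w + fps_X) * H) k
      = ?w * fps_nth H k + (if k = 0 then 0 else fps_nth H (k - 1))" for H
    by (simp add: distrib_right)
  have BB: "fps_nth (B * B) i = of_real (\<Sum>j = 0..i. beta_plus p n j * beta_plus p n (i - j))" for i
    by (simp add: fps_mult_nth Bn)
  have lhs: "fps_nth ((fps_const ?w + fps_X) * fps_deriv B) k
      = of_real (y * ((real k + 1) * beta_plus p n (k + 1)) + real k * beta_plus p n k)"
    unfolding shift by (simp add: Bn)
  have rhs: "fps_nth ((fps_const ?w + fps_X) * (B * B) - fps_const (of_real (p + 1)) * B + fps_const (1 / 4)) k
      = of_real (y * (\<Sum>i = 0..k. beta_plus p n i * beta_plus p n (k - i))
      + (if k = 0 then 1 / 4 else (\<Sum>i = 0..k - 1. beta_plus p n i * beta_plus p n (k - 1 - i)))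
      - (p + 1) * beta_plus p n k)"
    unfolding fps_add_nth fps_sub_nth shift BB by (simp add: Bn)
  show ?thesis using eq unfolding lhs rhs of_real_eq_iff .
qed

lemma beta_plus_0: "beta_plus p n 0 = 0"
  using D_fun_of_real[OF p bessel_zero_sq_pos] bessel_entire_succ_bessel_zero
  by (simp add: beta_plus_def y_def[symmetric] bessel_ratio_def)

text \<open>Multiplying the recurrence for \<open>beta_plus\<close> at \<open>l = k - 1\<close> by
  \<open>y ^ l\<close> turns it into the recurrence of the evaluated polynomials.\<close>

lemma beta_plus_eq_E_poly:
  assumes "k \<ge> 1"
  shows "y ^ k * beta_plus p n k = eval_py (E_poly k) p y"
  using assms
proof (induction k rule: less_induct)
  case (less k)
  show ?case
  proof (cases "k = 1")
    case True
    then show ?thesis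
      using beta_plus_recurrence[of 0] beta_plus_0 by (simp add: eval_py_def const_py_def)
  next
    case False
    define l where "l = k - 1"
    have l: "k = l + 1" "l \<ge> 1" using False less.prems by (auto simp: l_def)
    let ?b = "beta_plus p n" and ?e = "\<lambda>j. eval_py (E_poly j) p y"
    have IH: "y ^ j * ?b j = ?e j" if "1 \<le> j" "j \<le> l" for j
      using less.IH[of j] that l by simp
    have prod: "y ^ (i + j) * (?b i * ?b j) = ?e i * ?e j" if "1 \<le> i" "i \<le> l" "1 \<le> j" "j \<le> l" for i j
      using IH[of i] IH[of j] that by (simp add: power_add algebra_simps flip: IH)
    \<comment> \<open>Since \<open>beta_plus p n 0 = 0\<close>, the end terms vanish and the ranges
      agree with those of \<open>E_poly_rec\<close>.\<close>
    have S1: "(\<Sum>i = 0..l. ?b i * ?b (l - i)) = (\<Sum>i = 1..l - 1. ?b i * ?b (l - i))"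
      by (rule sum.mono_neutral_right) (use beta_plus_0 in \<open>auto simp: not_le\<close>)
    have S2: "(\<Sum>i = 0..l - 1. ?b i * ?b (l - 1 - i)) = (\<Sum>i = 1..l - 2. ?b i * ?b (l - 1 - i))"
      by (rule sum.mono_neutral_right) (use beta_plus_0 in \<open>auto simp: not_le\<close>)
    have P1: "y ^ l * (\<Sum>i = 1..l - 1. ?b i * ?b (l - i)) = (\<Sum>i = 1..l - 1. ?e i * ?e (l - i))"
      unfolding sum_distrib_left
    proof (rule sum.cong)
      fix i assume "i \<in> {1..l - 1}"
      then show "y ^ l * (?b i * ?b (l - i)) = ?e i * ?e (l - i)"
        using prod[of i "l - i"] by auto
    qed simp
    have P2: "y ^ l * (\<Sum>i = 1..l - 2. ?b i * ?b (l - 1 - i)) = y * (\<Sum>i = 1..l - 2. ?e i * ?e (l - 1 - i))"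
      unfolding sum_distrib_left
    proof (rule sum.cong)
      fix i assume i: "i \<in> {1..l - 2}"
      \<comment> \<open>The two indices add up to \<open>l - 1\<close> only; the spare power is the
        factor \<open>y\<close> before the second sum in \<open>E_poly_rec\<close>.\<close>
      then have "l = Suc (i + (l - 1 - i))" using l(2) by auto
      then have "y ^ l = y * y ^ (i + (l - 1 - i))" by (metis power_Suc)
      then show "y ^ l * (?b i * ?b (l - 1 - i)) = y * (?e i * ?e (l - 1 - i))"
        using prod[of i "l - 1 - i"] i by (auto simp: mult.assoc)
    qed simp
    have "(real l + 1) * (y ^ k * ?b k) = y ^ l * (y * ((real l + 1) * ?b (l + 1)))"
      by (simp add: l(1))
    also have "y * ((real l + 1) * ?b (l + 1)) = y * (\<Sum>i = 1..l - 1. ?b i * ?b (l - i))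
        + (\<Sum>i = 1..l - 2. ?b i * ?b (l - 1 - i)) - (real l + p + 1) * ?b l"
      using beta_plus_recurrence[of l] l(2) unfolding S1 S2 by (simp add: algebra_simps)
    also have "y ^ l * (y * (\<Sum>i = 1..l - 1. ?b i * ?b (l - i))
        + (\<Sum>i = 1..l - 2. ?b i * ?b (l - 1 - i)) - (real l + p + 1) * ?b l)
      = y * (y ^ l * (\<Sum>i = 1..l - 1. ?b i * ?b (l - i)))
        + y ^ l * (\<Sum>i = 1..l - 2. ?b i * ?b (l - 1 - i)) - (real l + p + 1) * (y ^ l * ?b l)"
      by (simp only: distrib_left right_diff_distrib mult.left_commute)
    also have "\<dots> = (real l + 1) * ?e k"
      unfolding P1 P2 using IH[of l] eval_py_E_poly_Suc[OF l(2)] l by simp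
    finally show ?thesis by simp
  qed
qed

text \<open>The sums over growing discs tend to \<open>beta_plus\<close>, so summability remains.
  For exponent \<open>2\<close> the terms are nonnegative and the limit itself gives it; for larger
  \<open>r\<close> the terms are dominated by a multiple of those.\<close>

lemma T_plus_eq_beta_plus:
  assumes r: "r \<ge> 2"
  shows "T_plus r p n = beta_plus p n (r - 1)"
proof -
  let ?Z = "bessel_zeros p"
  define g where "g = (\<lambda>r x. 1 / (x\<^sup>2 - y) ^ r :: real)"
  have fin: "finite {x \<in> ?Z. x\<^sup>2 \<le> R}" for R by (rule finite_bessel_zeros_le[OF p])
  have neq: "x\<^sup>2 \<noteq> y" if "x \<in> ?Z" for x
    using that bessel_entire_bessel_zero_succ_neq_0 by (auto simp: bessel_zeros_iff[OF p])
  have lim: "((\<lambda>R. \<Sum>x | x \<in> ?Z \<and> x\<^sup>2 \<le> R. g (k + 1) x) \<longlongrightarrow> beta_plus p n k) at_top" for k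
  proof -
    have "((\<lambda>R. \<Sum>a | bessel_entire p a = 0 \<and> norm a \<le> R. 1 / (a - of_real y) ^ (k + 1)) \<longlongrightarrow>
        (deriv ^^ k) (\<lambda>z. - deriv (bessel_entire p) z / bessel_entire p z) (of_real y) / fact k) at_top"
      by (intro sum_zeros_tendsto_higher_deriv holomorphic_bessel_entire bessel_entire_0_neq_0
          bessel_entire_growth deriv_bessel_entire_neq_0 finite_zeros_bessel_entire bessel_entire_bessel_zero_succ_neq_0 p)
    also have "(\<lambda>z. - deriv (bessel_entire p) z / bessel_entire p z) = bessel_ratio p"
      using bessel_ratio_eq_log_deriv[OF p] by blast
    also have "(deriv ^^ k) (bessel_ratio p) (of_real y) / fact k = of_real (beta_plus p n k)"
      by (simp add: higher_deriv_bessel_ratio beta_plus_def y_def[symmetric])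
    also have "(\<lambda>R. \<Sum>a | bessel_entire p a = 0 \<and> norm a \<le> R. 1 / (a - of_real y) ^ (k + 1))
        = (\<lambda>R. complex_of_real (\<Sum>x | x \<in> ?Z \<and> x\<^sup>2 \<le> R. g (k + 1) x))"
    proof
      fix R
      have "(\<Sum>a | bessel_entire p a = 0 \<and> norm a \<le> R. 1 / (a - of_real y) ^ (k + 1))
          = (\<Sum>x | x \<in> ?Z \<and> x\<^sup>2 \<le> R. 1 / (complex_of_real (x\<^sup>2) - of_real y) ^ (k + 1))"
        by (rule sum.reindex_bij_betw[OF bij_betw_bessel_zeros[OF p], symmetric])
      then show "(\<Sum>a | bessel_entire p a = 0 \<and> norm a \<le> R. 1 / (a - of_real y) ^ (k + 1))
          = complex_of_real (\<Sum>x | x \<in> ?Z \<and> x\<^sup>2 \<le> R. g (k + 1) x)"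
        by (simp add: g_def)
    qed
    finally show ?thesis by (simp only: tendsto_of_real_iff)
  qed
  have summable2: "g 2 summable_on ?Z"
    by (rule summable_on_sublevel_limit[OF fin])
       (use lim[of 1] in \<open>auto simp: g_def numeral_2_eq_2\<close>)
  \<comment> \<open>Outside this finite set \<open>x\<^sup>2 - y > 1\<close>, so
    \<open>g (r - 2)\<close> is at most \<open>1\<close> in modulus; its values on \<open>X\<close>
    are absorbed into \<open>M\<close>.\<close>
  define X where "X = {x \<in> ?Z. x\<^sup>2 \<le> y + 1}"
  define M where "M = 1 + (\<Sum>x\<in>X. \<bar>g (r - 2) x\<bar>)"
  have bound: "\<bar>g r x\<bar> \<le> M * g 2 x" if x: "x \<in> ?Z" for x
  proof -
    have "\<bar>g (r - 2) x\<bar> \<le> M"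
    proof (cases "x \<in> X")
      case True
      then have "\<bar>g (r - 2) x\<bar> \<le> (\<Sum>x\<in>X. \<bar>g (r - 2) x\<bar>)"
        using fin by (intro member_le_sum) (auto simp: X_def)
      then show ?thesis by (simp add: M_def)
    next
      case False
      then have "1 \<le> (x\<^sup>2 - y) ^ (r - 2)" using x by (intro one_le_power) (auto simp: X_def)
      then have "\<bar>g (r - 2) x\<bar> \<le> 1" by (simp add: g_def)
      also have "1 \<le> M" by (simp add: M_def sum_nonneg)
      finally show ?thesis .
    qed
    moreover have "(x\<^sup>2 - y) ^ r = (x\<^sup>2 - y) ^ (r - 2) * (x\<^sup>2 - y) ^ 2"
      using r by (metis le_add_diff_inverse2 power_add)
    then have "g r x = g (r - 2) x * g 2 x" by (simp add: g_def)
    moreover have "g 2 x \<ge> 0" by (simp add: g_def)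
    ultimately show ?thesis by (simp add: abs_mult mult_right_mono)
  qed
  have "(\<lambda>x. M * g 2 x) summable_on ?Z" using summable2 by (rule summable_on_cmult_right)
  then have "(\<lambda>x. norm (g r x)) summable_on ?Z"
    by (rule Infinite_Sum.abs_summable_on_comparison_test') (use bound in auto)
  then have "g r summable_on ?Z" by (rule abs_summable_summable)
  then have "infsum (g r) ?Z = beta_plus p n (r - 1)"
    using lim[of "r - 1"] r by (intro infsum_eq_sublevel_limit[OF fin]) auto
  moreover have "T_plus r p n = infsum (g r) ?Z"
    unfolding infsum_reindex_bij_betw[OF bij_betw_bessel_zero[OF p], symmetric]
    by (simp add: T_plus_def g_def y_def)
  ultimately show ?thesis by simp
qed

lemma gamma_plus_eq:
  assumes "k \<ge> 1"
  shows "gamma_plus p n k = y * eval_py (E_poly k) p y"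
  unfolding gamma_plus_def y_def[symmetric] beta_plus_eq_E_poly[OF assms, symmetric] by simp

lemma T_plus_eq:
  assumes "r \<ge> 2"
  shows "T_plus r p n = eval_py (E_poly (r - 1)) p y / y ^ (r - 1)"
proof -
  have "y ^ (r - 1) * beta_plus p n (r - 1) = eval_py (E_poly (r - 1)) p y"
    using assms by (intro beta_plus_eq_E_poly) simp
  then show ?thesis
    using bessel_zero_sq_pos by (simp add: T_plus_eq_beta_plus[OF assms] field_simps)
qed

end

theorem theorem2:
  shows
    "(\<forall>k::nat. \<forall>p::real. \<forall>n::nat. k \<ge> 1 \<longrightarrow> p > -1 \<longrightarrow> n \<ge> 1 \<longrightarrow>
        gamma_plus p n k =
          (bessel_zero (p + 1) n)\<^sup>2 * eval_py (E_poly k) p ((bessel_zero (p + 1) n)\<^sup>2))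
     \<and> (\<forall>k::nat. k \<ge> 1 \<longrightarrow>
        degree_y (E_poly k) = (k - 1) div 2
        \<and> degree_p (E_poly k) = k - 1
        \<and> coeff_p (E_poly k) (k - 1) = [:(-1) ^ (k - 1) / (4 * fact k):])
     \<and> (\<forall>r::nat. \<forall>p::real. \<forall>n::nat. r \<ge> 2 \<longrightarrow> p > -1 \<longrightarrow> n \<ge> 1 \<longrightarrow>
        T_plus r p n =
          eval_py (E_poly (r - 1)) p ((bessel_zero (p + 1) n)\<^sup>2)
            / ((bessel_zero (p + 1) n)\<^sup>2) ^ (r - 1))
     \<and> (\<forall>r::nat. r \<ge> 2 \<longrightarrow>
        degree_y (E_poly (r - 1)) = (r - 2) div 2
        \<and> degree_p (E_poly (r - 1)) = r - 2
        \<and> degree (subst_square (E_poly (r - 1))) = 2 * ((r - 2) div 2)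
        \<and> 2 * ((r - 2) div 2) = (if even r then r - 2 else r - 3))"
proof (intro conjI allI impI)
  fix r :: nat assume r: "r \<ge> 2"
  then have "r - 1 \<ge> 1" "r - 1 - 1 = r - 2" by auto
  then show "degree_y (E_poly (r - 1)) = (r - 2) div 2" "degree_p (E_poly (r - 1)) = r - 2"
      "degree (subst_square (E_poly (r - 1))) = 2 * ((r - 2) div 2)"
    using degree_E_poly[of "r - 1"] degree_p_E_poly[of "r - 1"]
    by (simp_all add: degree_y_def degree_subst_square)
  \<comment> \<open>An odd \<open>r\<close> is at least \<open>3\<close>, so \<open>r - 3\<close> is
    not truncated.\<close>
  show "2 * ((r - 2) div 2) = (if even r then r - 2 else r - 3)"
    using r by auto
qed (auto simp: gamma_plus_eq T_plus_eq degree_y_def degree_E_poly degree_p_E_poly coeff_p_E_poly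
    simp del: One_nat_def)

end
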